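(* Let $(\mathfrak g,[\cdot,\cdot,\cdot]_{\mathfrak g})$ and $(\mathfrak h,[\cdot,\cdot,\cdot]_{\mathfrak h})$ be two $3$-Lie algebras over $\mathbb K$. Then the isomorphism classes of non-abelian extensions of $\mathfrak g$ by $\mathfrak h$ are in one-to-one correspondence with the gauge equivalence classes of Maurer-Cartan elements in the DGLA $(C_>(\mathfrak g\oplus\mathfrak h,\mathfrak h),[\cdot,\cdot]^{\rm 3Lie},\overline{\delta})$.
   Context: $\mathbb K$ is an algebraically closed field of characteristic $0$; all vector spaces are over $\mathbb K$. **3-Lie algebras.** A $3$-Lie algebra is a vector space $\mathfrak g$ with a skew-symmetric linear map $[\cdot,\cdot,\cdot]_{\mathfrak g}:\wedge^3\mathfrak g\to\mathfrak g$ such that for all $x_1,\dots,x_5\in\mathfrak g$, $$[x_1,x_2,[x_3,x_4,x_5]]=[[x_1,x_2,x_3],x_4,x_5]+[x_3,[x_1,x_2,x_4],x_5]+[x_3,x_4,[x_1,x_2,x_5]].$$ A morphism of $3$-Lie algebras is a linear map preserving the brackets. **Extensions.** A non-abelian extension of a $3$-Lie algebra $\mathfrak g$ by a $3$-Lie algebra $\mathfrak h$ is a short exact sequence of $3$-Lie algebra morphisms $0\to\mathfrak h\xrightarrow{\iota}\hat{\mathfrak g}\xrightarrow{p}\mathfrak g\to 0$, with $\hat{\mathfrak g}$ a $3$-Lie algebra. Two extensions $(\hat{\mathfrak g}_1,\iota_1,p_1)$ and $(\hat{\mathfrak g}_2,\iota_2,p_2)$ are isomorphic if there is a $3$-Lie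 algebra morphism $\theta:\hat{\mathfrak g}_2\to\hat{\mathfrak g}_1$ with $\theta\circ\iota_2=\iota_1$ and $p_1\circ\theta=p_2$. **The graded Lie algebra.** For a vector space $V$, let $C^0(V,V)=\mathrm{Hom}(V,V)$ and, for $p\ge1$, let $C^p(V,V)=\mathrm{Hom}\big((\wedge^2V)^{\otimes(p-1)}\otimes\wedge^3V,V\big)$; elements are written $\alpha(X_1,\dots,X_p,x)$ with $X_i=x_i\wedge y_i\in\wedge^2V$, $x\in V$ (skew-symmetric in $x_p,y_p,x$). A permutation $\sigma$ of $\{1,\dots,n\}$ is an $(i,n-i)$-unshuffle if $\sigma(1)<\dots<\sigma(i)$ and $\sigma(i+1)<\dots<\sigma(n)$ ($\sigma=\mathrm{Id}$ if $i=0$ or $i=n$); $unsh(i,n-i)$ is the set of these, and $(-1)^\sigma$ denotes the sign of $\sigma$. For $\alpha\in C^p(V,V)$, $\beta\in C^q(V,V)$ define $\alpha\circ\beta\in C^{p+q}(V,V)$ by $$\begin{aligned}\alpha\circ\beta(X_1,\dots,X_{p+q},x)=&\sum_{k=0}^{p-1}(-1)^{kq}\sum_{\sigma\in unsh(k,q)}(-1)^\sigma\Big(\alpha\big(X_{\sigma(1)},\dots,X_{\sigma(k)},\beta(X_{\sigma(k+1)},\dots,X_{\sigma(k+q)},x_{k+q+1})\wedge y_{k+q+1},X_{k+q+2},\dots,X_{p+q},x\big)\\&+\alpha\big(X_{\sigma(1)},\dots,X_{\sigma(k)},x_{k+q+1}\wedge\beta(X_{\sigma(k+1)},\dots,X_{\sigma(k+q)},y_{k+q+1}),X_{k+q+2},\dots,X_{p+q},x\big)\Big)\\&+\sum_{\sigma\in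 unsh(p,q)}(-1)^{pq}(-1)^\sigma\alpha\big(X_{\sigma(1)},\dots,X_{\sigma(p)},\beta(X_{\sigma(p+1)},\dots,X_{\sigma(p+q)},x)\big).\end{aligned}$$ Then $[\alpha,\beta]^{\rm 3Lie}=\alpha\circ\beta-(-1)^{pq}\beta\circ\alpha$ makes $C^*(V,V)=\oplus_pC^p(V,V)$ a graded Lie algebra (known). **The DGLA.** Let $V=\mathfrak g\oplus\mathfrak h$ be the direct sum $3$-Lie algebra, with bracket $[x+u,y+v,z+w]=[x,y,z]_{\mathfrak g}+[u,v,w]_{\mathfrak h}$; regard this bracket as an element $\mu_{\mathfrak g}+\mu_{\mathfrak h}\in C^1(V,V)$, and put $\overline\delta P=[\mu_{\mathfrak g}+\mu_{\mathfrak h},P]^{\rm 3Lie}$. Let $C^k(\mathfrak g\oplus\mathfrak h,\mathfrak h)\subset C^k(V,V)$ be the cochains with values in $\mathfrak h$, and let $C^k_>(\mathfrak g\oplus\mathfrak h,\mathfrak h)$ be its subspace of cochains that vanish when all arguments are in $\mathfrak h$, so that $C^k(\mathfrak g\oplus\mathfrak h,\mathfrak h)=C^k_>(\mathfrak g\oplus\mathfrak h,\mathfrak h)\oplus C^k(\mathfrak h,\mathfrak h)$. Put $C_>(\mathfrak g\oplus\mathfrak h,\mathfrak h)=\oplus_kC^k_>(\mathfrak g\oplus\mathfrak h,\mathfrak h)$; it is a sub-DGLA of $(C^*(V,V),[\cdot,\cdot]^{\rm 3Lie},\overline\delta)$ with degree $0$ part $\mathrm{Hom}(\mathfrak g,\mathfrak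 h)$. **Maurer-Cartan elements.** For a DGLA $(L,[\cdot,\cdot],\mathrm d)$, the set of Maurer-Cartan elements is $MC(L)=\{P\in L_1\mid \mathrm dP+\frac12[P,P]=0\}$. Elements $P_0,P_1\in MC(L)$ are gauge equivalent if there is $\xi\in L_0$ with $$P_1=e^{\mathrm{ad}_\xi}P_0-\frac{e^{\mathrm{ad}_\xi}-1}{\mathrm{ad}_\xi}\mathrm d\xi,$$ where $\mathrm{ad}_\xi=[\xi,\cdot]$, $e^{\mathrm{ad}_\xi}=\sum_{n\ge0}\frac{1}{n!}\mathrm{ad}_\xi^n$ and $\frac{e^{\mathrm{ad}_\xi}-1}{\mathrm{ad}_\xi}=\sum_{n\ge1}\frac1{n!}\mathrm{ad}_\xi^{n-1}$ (for $L=C_>(\mathfrak g\oplus\mathfrak h,\mathfrak h)$ only finitely many terms are nonzero in these expressions). *)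

theory Defs
  imports
    "HOL-Algebra.Module"
    "HOL-Combinatorics.Permutations"
    "HOL-Computational_Algebra.Polynomial"
    "HOL-Library.Function_Algebras"
    "HOL-Library.Groups_Big_Fun"
    "HOL-Analysis.Product_Vector"
begin

text \<open>
  The middle term of an extension is an arbitrary vector space, so these notions are carrier-based.
  The fields \<open>mult\<close> and \<open>one\<close> that the library record of modules inherits from rings play no role.
\<close>

definition class_field :: "'k::field ring" where
  "class_field = \<lparr>carrier = UNIV, monoid.mult = (*), one = 1, ring.zero = 0, add = (+)\<rparr>"

record ('k, 'a) algebra3 = "('k, 'a) module" +
  bracket :: "'a \<Rightarrow> 'a \<Rightarrow> 'a \<Rightarrow> 'a"

definition linear_maps ::
    "('k, 'a, 'x) module_scheme \<Rightarrow> ('k, 'b, 'y) module_scheme \<Rightarrow> ('a \<Rightarrow> 'b) set" where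
  "linear_maps L M = {f \<in> carrier L \<rightarrow> carrier M.
     (\<forall>x\<in>carrier L. \<forall>y\<in>carrier L. f (x \<oplus>\<^bsub>L\<^esub> y) = f x \<oplus>\<^bsub>M\<^esub> f y) \<and>
     (\<forall>c. \<forall>x\<in>carrier L. f (c \<odot>\<^bsub>L\<^esub> x) = c \<odot>\<^bsub>M\<^esub> f x)}"

locale three_lie_algebra = Module.module class_field L
  for L :: "('k::field, 'a) algebra3" +
  assumes bracket_linear1:
      "\<lbrakk>y \<in> carrier L; z \<in> carrier L\<rbrakk> \<Longrightarrow> (\<lambda>x. bracket L x y z) \<in> linear_maps L L"
    and bracket_linear2:
      "\<lbrakk>x \<in> carrier L; z \<in> carrier L\<rbrakk> \<Longrightarrow> (\<lambda>y. bracket L x y z) \<in> linear_maps L L"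
    and bracket_linear3:
      "\<lbrakk>x \<in> carrier L; y \<in> carrier L\<rbrakk> \<Longrightarrow> (\<lambda>z. bracket L x y z) \<in> linear_maps L L"
    and bracket_skew12:
      "\<lbrakk>x \<in> carrier L; y \<in> carrier L; z \<in> carrier L\<rbrakk>
        \<Longrightarrow> bracket L y x z = \<ominus>\<^bsub>L\<^esub> bracket L x y z"
    and bracket_skew23:
      "\<lbrakk>x \<in> carrier L; y \<in> carrier L; z \<in> carrier L\<rbrakk>
        \<Longrightarrow> bracket L x z y = \<ominus>\<^bsub>L\<^esub> bracket L x y z"
    and fundamental_identity:
      "\<lbrakk>x1 \<in> carrier L; x2 \<in> carrier L; x3 \<in> carrier L; x4 \<in> carrier L; x5 \<in> carrier L\<rbrakk>
        \<Longrightarrow> bracket L x1 x2 (bracket L x3 x4 x5) =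
            bracket L (bracket L x1 x2 x3) x4 x5 \<oplus>\<^bsub>L\<^esub> bracket L x3 (bracket L x1 x2 x4) x5
              \<oplus>\<^bsub>L\<^esub> bracket L x3 x4 (bracket L x1 x2 x5)"

definition three_lie_morphisms ::
    "('k, 'a) algebra3 \<Rightarrow> ('k, 'b) algebra3 \<Rightarrow> ('a \<Rightarrow> 'b) set" where
  "three_lie_morphisms L M = {f \<in> linear_maps L M.
     \<forall>x\<in>carrier L. \<forall>y\<in>carrier L. \<forall>z\<in>carrier L.
       f (bracket L x y z) = bracket M (f x) (f y) (f z)}"

record ('k, 'h, 'e, 'g) extension =
  middle :: "('k, 'e) algebra3"
  incl :: "'h \<Rightarrow> 'e"
  proj :: "'e \<Rightarrow> 'g"

definition extensions ::
    "('k::field, 'g) algebra3 \<Rightarrow> ('k, 'h) algebra3 \<Rightarrow> ('k, 'h, 'e, 'g) extension set" where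
  "extensions G H = {X.
     three_lie_algebra (middle X) \<and>
     incl X \<in> three_lie_morphisms H (middle X) \<and>
     proj X \<in> three_lie_morphisms (middle X) G \<and>
     inj_on (incl X) (carrier H) \<and>
     incl X ` carrier H = {x \<in> carrier (middle X). proj X x = \<zero>\<^bsub>G\<^esub>} \<and>
     proj X ` carrier (middle X) = carrier G}"

definition ext_isomorphic ::
    "('k, 'h) algebra3 \<Rightarrow> ('k, 'h, 'e1, 'g) extension \<Rightarrow> ('k, 'h, 'e2, 'g) extension \<Rightarrow> bool" where
  "ext_isomorphic H X1 X2 \<longleftrightarrow> (\<exists>\<theta> \<in> three_lie_morphisms (middle X2) (middle X1).
     (\<forall>u \<in> carrier H. \<theta> (incl X2 u) = incl X1 u) \<and>
     (\<forall>x \<in> carrier (middle X2). proj X1 (\<theta> x) = proj X2 x))"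

definition ext_rel ::
    "('k::field, 'g) algebra3 \<Rightarrow> ('k, 'h) algebra3 \<Rightarrow> ('k, 'h, 'e, 'g) extension rel" where
  "ext_rel G H = {(X1, X2). X1 \<in> extensions G H \<and> X2 \<in> extensions G H \<and> ext_isomorphic H X1 X2}"

definition type_algebra3 ::
    "('k \<Rightarrow> 'v \<Rightarrow> 'v) \<Rightarrow> ('v \<Rightarrow> 'v \<Rightarrow> 'v \<Rightarrow> 'v) \<Rightarrow> ('k, 'v::ab_group_add) algebra3" where
  "type_algebra3 s b = \<lparr>carrier = UNIV, monoid.mult = (\<lambda>_ _. 0), one = 0,
     ring.zero = 0, add = (+), module.smult = s, bracket = b\<rparr>"

text \<open>
  A cochain of degree \<open>p\<close> takes the list of the \<open>p\<close> pairs representing \<open>X\<^sub>i = x\<^sub>i \<and> y\<^sub>i\<close> and the last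
  argument \<open>x\<close>; by the universal properties of tensor and exterior powers it is a function that is
  linear in each of its \<open>2 p + 1\<close> vector arguments, with the stated skew symmetries. On lists of
  another length it is set to \<open>0\<close>, so that equality of cochains is equality of functions.
\<close>

type_synonym 'v cochain = "('v \<times> 'v) list \<Rightarrow> 'v \<Rightarrow> 'v"

definition cochains ::
    "('k::field \<Rightarrow> 'v \<Rightarrow> 'v) \<Rightarrow> nat \<Rightarrow> 'v::ab_group_add cochain set" where
  "cochains s p = {\<alpha>.
     (\<forall>Xs x. length Xs \<noteq> p \<longrightarrow> \<alpha> Xs x = 0) \<and>
     (\<forall>Xs. length Xs = p \<longrightarrow> Vector_Spaces.linear s s (\<alpha> Xs)) \<and>
     (\<forall>Xs i x. length Xs = p \<longrightarrow> i < p \<longrightarrow>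
        (\<forall>b. Vector_Spaces.linear s s (\<lambda>a. \<alpha> (Xs[i := (a, b)]) x)) \<and>
        (\<forall>a. Vector_Spaces.linear s s (\<lambda>b. \<alpha> (Xs[i := (a, b)]) x)) \<and>
        (\<forall>a b. \<alpha> (Xs[i := (b, a)]) x = - \<alpha> (Xs[i := (a, b)]) x)) \<and>
     (\<forall>Xs a b x. Suc (length Xs) = p \<longrightarrow> \<alpha> (Xs @ [(a, x)]) b = - \<alpha> (Xs @ [(a, b)]) x)}"

text \<open>Unshuffles and list positions are indexed from \<open>0\<close>.\<close>

definition unsh :: "nat \<Rightarrow> nat \<Rightarrow> (nat \<Rightarrow> nat) set" where
  "unsh i j = {\<sigma>. \<sigma> permutes {..<i + j} \<and>
     strict_mono_on {..<i} \<sigma> \<and> strict_mono_on {i..<i + j} \<sigma>}"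

definition circ ::
    "('k::field \<Rightarrow> 'v \<Rightarrow> 'v) \<Rightarrow> nat \<Rightarrow> nat \<Rightarrow> 'v cochain \<Rightarrow> 'v cochain \<Rightarrow> 'v::ab_group_add cochain"
  where
  "circ s p q \<alpha> \<beta> = (\<lambda>Xs x. if length Xs \<noteq> p + q then 0 else
     (\<Sum>k<p. s ((-1) ^ (k * q)) (\<Sum>\<sigma>\<in>unsh k q. s (of_int (sign \<sigma>))
        (let As = map (\<lambda>i. Xs ! \<sigma> i) [0..<k];
             Bs = map (\<lambda>i. Xs ! \<sigma> i) [k..<k + q];
             (a, b) = Xs ! (k + q);
             Cs = drop (k + q + 1) Xs
         in \<alpha> (As @ (\<beta> Bs a, b) # Cs) x + \<alpha> (As @ (a, \<beta> Bs b) # Cs) x)))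
     + (\<Sum>\<sigma>\<in>unsh p q. s ((-1) ^ (p * q)) (s (of_int (sign \<sigma>))
          (\<alpha> (map (\<lambda>i. Xs ! \<sigma> i) [0..<p]) (\<beta> (map (\<lambda>i. Xs ! \<sigma> i) [p..<p + q]) x)))))"

definition cochain_scale :: "('k \<Rightarrow> 'v \<Rightarrow> 'v) \<Rightarrow> 'k \<Rightarrow> 'v cochain \<Rightarrow> 'v cochain" where
  "cochain_scale s c \<alpha> = (\<lambda>Xs x. s c (\<alpha> Xs x))"

definition bracket_3Lie ::
    "('k::field \<Rightarrow> 'v \<Rightarrow> 'v) \<Rightarrow> nat \<Rightarrow> nat \<Rightarrow> 'v cochain \<Rightarrow> 'v cochain \<Rightarrow> 'v::ab_group_add cochain"
  where
  "bracket_3Lie s p q \<alpha> \<beta> =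
     circ s p q \<alpha> \<beta> - cochain_scale s ((-1) ^ (p * q)) (circ s q p \<beta> \<alpha>)"

definition cochain_of_bracket :: "('v \<Rightarrow> 'v \<Rightarrow> 'v \<Rightarrow> 'v) \<Rightarrow> 'v::ab_group_add cochain" where
  "cochain_of_bracket b = (\<lambda>Xs z. case Xs of [(x, y)] \<Rightarrow> b x y z | _ \<Rightarrow> 0)"

text \<open>
  The graded bracket and the differential take the degrees of their homogeneous arguments
  as additional parameters.
\<close>

record ('k, 'a) dgla =
  dg_part :: "nat \<Rightarrow> 'a set"
  dg_scale :: "'k \<Rightarrow> 'a \<Rightarrow> 'a"
  dg_bracket :: "nat \<Rightarrow> nat \<Rightarrow> 'a \<Rightarrow> 'a \<Rightarrow> 'a"
  dg_diff :: "nat \<Rightarrow> 'a \<Rightarrow> 'a"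

definition MC :: "('k::field, 'a::ab_group_add) dgla \<Rightarrow> 'a set" where
  "MC L = {P \<in> dg_part L 1. dg_diff L 1 P + dg_scale L (1 / 2) (dg_bracket L 1 1 P P) = 0}"

text \<open>
  \<open>Sum_any\<close> is the sum of a finitely supported family; \<open>ad\<^sub>\<xi>\<close> has degree \<open>0\<close> and
  is applied here only to elements of degree \<open>1\<close>.
\<close>

definition gauge_action :: "('k::field_char_0, 'a::ab_group_add) dgla \<Rightarrow> 'a \<Rightarrow> 'a \<Rightarrow> 'a" where
  "gauge_action L \<xi> P =
     (let ad = dg_bracket L 0 1 \<xi> in
      Sum_any (\<lambda>n. dg_scale L (1 / fact n) ((ad ^^ n) P))
      - Sum_any (\<lambda>n. if n = 0 then 0
                     else dg_scale L (1 / fact n) ((ad ^^ (n - 1)) (dg_diff L 0 \<xi>))))"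

definition gauge_rel :: "('k::field_char_0, 'a::ab_group_add) dgla \<Rightarrow> 'a rel" where
  "gauge_rel L = {(P0, P1). P0 \<in> MC L \<and> P1 \<in> MC L \<and> (\<exists>\<xi> \<in> dg_part L 0. P1 = gauge_action L \<xi> P0)}"

definition sum_bracket ::
    "('g \<Rightarrow> 'g \<Rightarrow> 'g \<Rightarrow> 'g) \<Rightarrow> ('h \<Rightarrow> 'h \<Rightarrow> 'h \<Rightarrow> 'h) \<Rightarrow>
     'g \<times> 'h \<Rightarrow> 'g \<times> 'h \<Rightarrow> 'g \<times> 'h \<Rightarrow> 'g \<times> 'h" where
  "sum_bracket bg bh v w t =
     (bg (fst v) (fst w) (fst t), bh (snd v) (snd w) (snd t))"

definition cochains_gt ::
    "('k::field \<Rightarrow> 'g \<times> 'h \<Rightarrow> 'g \<times> 'h) \<Rightarrow> nat \<Rightarrow> ('g::ab_group_add \<times> 'h::ab_group_add) cochain set"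
  where
  "cochains_gt s k = {\<alpha> \<in> cochains s k.
     (\<forall>Xs x. fst (\<alpha> Xs x) = 0) \<and>
     (\<forall>Xs x. (\<forall>(a, b) \<in> set Xs. fst a = 0 \<and> fst b = 0) \<longrightarrow> fst x = 0 \<longrightarrow> \<alpha> Xs x = 0)}"

definition dgla_gt ::
    "('k::field \<Rightarrow> 'g::ab_group_add \<Rightarrow> 'g) \<Rightarrow> ('k \<Rightarrow> 'h::ab_group_add \<Rightarrow> 'h) \<Rightarrow>
     ('g \<Rightarrow> 'g \<Rightarrow> 'g \<Rightarrow> 'g) \<Rightarrow> ('h \<Rightarrow> 'h \<Rightarrow> 'h \<Rightarrow> 'h) \<Rightarrow> ('k, ('g \<times> 'h) cochain) dgla" where
  "dgla_gt sg sh bg bh =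
     (let s = module_prod.scale sg sh in
      \<lparr>dg_part = cochains_gt s,
       dg_scale = cochain_scale s,
       dg_bracket = bracket_3Lie s,
       dg_diff = (\<lambda>p. bracket_3Lie s 1 p (cochain_of_bracket (sum_bracket bg bh)))\<rparr>)"

text \<open>The extension on \<open>\<gg> \<oplus> \<hh>\<close> with bracket \<open>\<mu>\<^sub>\<gg> + \<mu>\<^sub>\<hh> + P\<close> given by a Maurer-Cartan element \<open>P\<close>.\<close>

definition mc_extension ::
    "('k::field \<Rightarrow> 'g::ab_group_add \<Rightarrow> 'g) \<Rightarrow> ('k \<Rightarrow> 'h::ab_group_add \<Rightarrow> 'h) \<Rightarrow>
     ('g \<Rightarrow> 'g \<Rightarrow> 'g \<Rightarrow> 'g) \<Rightarrow> ('h \<Rightarrow> 'h \<Rightarrow> 'h \<Rightarrow> 'h) \<Rightarrow> ('g \<times> 'h) cochain \<Rightarrow>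
     ('k, 'h, 'g \<times> 'h, 'g) extension" where
  "mc_extension sg sh bg bh P =
     \<lparr>middle = type_algebra3 (module_prod.scale sg sh)
        (\<lambda>x y z. sum_bracket bg bh x y z + P [(x, y)] z),
      incl = (\<lambda>u. (0, u)), proj = fst\<rparr>"

end

theory Submission
  imports Defs
begin

text \<open>
  A cochain \<open>P\<close> of degree 1 is Maurer-Cartan iff \<open>\<mu> + P\<close> satisfies the fundamental identity, where
  \<open>\<mu> = \<mu>\<^sub>\<gg> + \<mu>\<^sub>\<hh>\<close>: the composition \<open>\<pi> \<circ> \<pi>\<close> is the defect of that identity, and \<open>\<mu> \<circ> \<mu> = 0\<close>.
  So Maurer-Cartan elements are the extensions on \<open>\<gg> \<oplus> \<hh>\<close> with the canonical injection and projection.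
  An element \<open>\<xi>\<close> of degree 0 squares to zero as an endomorphism, so \<open>exp \<xi> = 1 + \<xi>\<close>, and since
  \<open>d \<xi> = - [\<xi>, \<mu>]\<close>, the gauge action by \<open>\<xi>\<close> is conjugation of \<open>\<mu> + P\<close> by \<open>1 + \<xi>\<close>. The maps
  \<open>1 + \<xi>\<close> are exactly the linear automorphisms of \<open>\<gg> \<oplus> \<hh>\<close> compatible with injection and projection.
  Finally, a linear section of the projection identifies any extension with one on \<open>\<gg> \<oplus> \<hh>\<close>.
\<close>

section \<open>3-Lie algebras on carriers and on types\<close>

lemma cring_class_field: "cring (class_field :: 'k::field ring)"
proof (rule cringI)
  show "abelian_group (class_field :: 'k ring)"
  proof (rule abelian_groupI)
    fix x :: 'k
    show "\<exists>y\<in>carrier class_field. y \<oplus>\<^bsub>class_field\<^esub> x = \<zero>\<^bsub>class_field\<^esub>"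
      by (rule bexI[of _ "- x"]) (auto simp: class_field_def)
  qed (auto simp: class_field_def algebra_simps)
qed (auto simp: class_field_def algebra_simps intro!: comm_monoidI)

section \<open>The axioms of a 3-Lie algebra on a whole type\<close>

lemma type_algebra3_simps [simp]:
  "carrier (type_algebra3 s b) = UNIV"
  "\<zero>\<^bsub>type_algebra3 s b\<^esub> = 0"
  "x \<oplus>\<^bsub>type_algebra3 s b\<^esub> y = x + y"
  "c \<odot>\<^bsub>type_algebra3 s b\<^esub> x = s c x"
  "bracket (type_algebra3 s b) = b"
  by (simp_all add: type_algebra3_def)

lemma class_field_simps [simp]:
  "carrier class_field = UNIV" "a \<otimes>\<^bsub>class_field\<^esub> b = a * b"
  "a \<oplus>\<^bsub>class_field\<^esub> b = a + b" "\<one>\<^bsub>class_field\<^esub> = 1" "\<zero>\<^bsub>class_field\<^esub> = 0"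
  by (simp_all add: class_field_def)

lemma abelian_group_type_algebra3: "abelian_group (type_algebra3 s b)"
proof (rule abelian_groupI)
  fix x :: 'a
  show "\<exists>y\<in>carrier (type_algebra3 s b). y \<oplus>\<^bsub>type_algebra3 s b\<^esub> x = \<zero>\<^bsub>type_algebra3 s b\<^esub>"
    by (rule bexI[of _ "- x"]) auto
qed (auto simp: algebra_simps)

lemma a_inv_type_algebra3 [simp]: "\<ominus>\<^bsub>type_algebra3 s b\<^esub> x = - x"
proof -
  interpret abelian_group "type_algebra3 s b" by (rule abelian_group_type_algebra3)
  show ?thesis by (rule minus_equality) auto
qed

lemma module_type_algebra3_iff:
  "Module.module class_field (type_algebra3 s b) \<longleftrightarrow> vector_space s"
  using cring_class_field abelian_group_type_algebra3[of s b]
  by (auto simp: Module.module_def module_axioms_def vector_space_def)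

lemma linear_maps_type_algebra3_iff:
  assumes "vector_space s" "vector_space t"
  shows "f \<in> linear_maps (type_algebra3 s b) (type_algebra3 t c) \<longleftrightarrow> Vector_Spaces.linear s t f"
  using assms by (auto simp: linear_maps_def Vector_Spaces.linear_iff)

text \<open>The two adjacent transpositions generate all permutations of the arguments. When 2 is
  invertible, these are the linear maps on the third exterior power, that is, the cochains of degree
  1.\<close>

definition alternating3 ::
    "('k::field \<Rightarrow> 'v \<Rightarrow> 'v) \<Rightarrow> ('v \<Rightarrow> 'v \<Rightarrow> 'v \<Rightarrow> 'v::ab_group_add) \<Rightarrow> bool" where
  "alternating3 s f \<longleftrightarrow>
     (\<forall>y z. Vector_Spaces.linear s s (\<lambda>x. f x y z)) \<and>
     (\<forall>x z. Vector_Spaces.linear s s (\<lambda>y. f x y z)) \<and>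
     (\<forall>x y. Vector_Spaces.linear s s (f x y)) \<and>
     (\<forall>x y z. f y x z = - f x y z) \<and> (\<forall>x y z. f x z y = - f x y z)"

text \<open>Equivalently, each operator \<open>f x1 x2\<close> is a derivation of the operation
  \<open>f\<close>.\<close>

definition filippov :: "('v \<Rightarrow> 'v \<Rightarrow> 'v \<Rightarrow> 'v::ab_group_add) \<Rightarrow> bool" where
  "filippov f \<longleftrightarrow> (\<forall>x1 x2 x3 x4 x5.
     f x1 x2 (f x3 x4 x5) = f (f x1 x2 x3) x4 x5 + f x3 (f x1 x2 x4) x5 + f x3 x4 (f x1 x2 x5))"

text \<open>Bridge from the carrier-based axioms to total functions on a type, where the cochain
  computations take place.\<close>

lemma three_lie_algebra_type_algebra3_iff:
  "three_lie_algebra (type_algebra3 s b) \<longleftrightarrow> vector_space s \<and> alternating3 s b \<and> filippov b"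
  by (cases "vector_space s")
    (simp_all add: three_lie_algebra_def three_lie_algebra_axioms_def module_type_algebra3_iff
      alternating3_def filippov_def linear_maps_type_algebra3_iff)

lemma alternating3_simps:
  assumes "alternating3 s f"
  shows "f (x + x') y z = f x y z + f x' y z" "f x (y + y') z = f x y z + f x y' z"
    "f x y (z + z') = f x y z + f x y z'" "f (s c x) y z = s c (f x y z)"
    "f x (s c y) z = s c (f x y z)" "f x y (s c z) = s c (f x y z)"
    "f (x - x') y z = f x y z - f x' y z" "f x (y - y') z = f x y z - f x y' z"
    "f x y (z - z') = f x y z - f x y z'" "f (- x) y z = - f x y z"
    "f x (- y) z = - f x y z" "f x y (- z) = - f x y z"
    "f 0 y z = 0" "f x 0 z = 0" "f x y 0 = 0"
proof -
  have l: "module_hom s s (\<lambda>x. f x y z)" "module_hom s s (\<lambda>x. f y x z)"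
    "module_hom s s (f y z)" for y z
    using assms unfolding alternating3_def linear_iff_module_hom by blast+
  note r = module_hom.add module_hom.scale module_hom.diff module_hom.neg module_hom.zero
  show "f (x + x') y z = f x y z + f x' y z" "f (s c x) y z = s c (f x y z)"
    "f (x - x') y z = f x y z - f x' y z" "f (- x) y z = - f x y z" "f 0 y z = 0"
    by (rule r[OF l(1)])+
  show "f x (y + y') z = f x y z + f x y' z" "f x (s c y) z = s c (f x y z)"
    "f x (y - y') z = f x y z - f x y' z" "f x (- y) z = - f x y z" "f x 0 z = 0"
    by (rule r[OF l(2)])+
  show "f x y (z + z') = f x y z + f x y z'" "f x y (s c z) = s c (f x y z)"
    "f x y (z - z') = f x y z - f x y z'" "f x y (- z) = - f x y z" "f x y 0 = 0"
    by (rule r[OF l(3)])+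
qed

text \<open>Transport of structure: every element of \<open>M\<close> is the image of one of
  \<open>L\<close>, and each axiom is pulled back along \<open>f\<close>. It serves twice: to carry
  the bracket of an arbitrary extension over to \<gg> \<oplus> \<hh>, and to copy an extension on
  \<gg> \<oplus> \<hh> into another type.\<close>

lemma bij_three_lie_algebra:
  assumes L: "three_lie_algebra L" and f: "bij_betw f (carrier L) (carrier M)"
    and add: "\<And>x y. x \<in> carrier L \<Longrightarrow> y \<in> carrier L \<Longrightarrow> f (x \<oplus>\<^bsub>L\<^esub> y) = f x \<oplus>\<^bsub>M\<^esub> f y"
    and zero: "f \<zero>\<^bsub>L\<^esub> = \<zero>\<^bsub>M\<^esub>"
    and scale: "\<And>c x. x \<in> carrier L \<Longrightarrow> f (c \<odot>\<^bsub>L\<^esub> x) = c \<odot>\<^bsub>M\<^esub> f x"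
    and br: "\<And>x y z. x \<in> carrier L \<Longrightarrow> y \<in> carrier L \<Longrightarrow> z \<in> carrier L \<Longrightarrow>
      f (bracket L x y z) = bracket M (f x) (f y) (f z)"
  shows "three_lie_algebra M"
proof -
  interpret L: three_lie_algebra L by (rule L)
  have car: "carrier M = f ` carrier L" using f by (simp add: bij_betw_def)
  have brc: "bracket L x y z \<in> carrier L"
    if "x \<in> carrier L" "y \<in> carrier L" "z \<in> carrier L" for x y z
    using L.bracket_linear1[of y z] that unfolding linear_maps_def by blast
  have smc: "c \<odot>\<^bsub>L\<^esub> x \<in> carrier L" if "x \<in> carrier L" for c x
    using L.smult_closed that by simp
  note closed = brc smc L.a_closed L.zero_closed L.a_inv_closed
  note hom = add[symmetric] zero[symmetric] scale[symmetric] br[symmetric]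
  have ag: "abelian_group M"
  proof (rule abelian_groupI)
    fix x assume "x \<in> carrier M"
    then obtain a where a: "a \<in> carrier L" "x = f a" using car by auto
    have "f (\<ominus>\<^bsub>L\<^esub> a) \<oplus>\<^bsub>M\<^esub> x = \<zero>\<^bsub>M\<^esub>" "f (\<ominus>\<^bsub>L\<^esub> a) \<in> carrier M"
      using a car by (simp_all add: hom L.l_neg)
    then show "\<exists>y\<in>carrier M. y \<oplus>\<^bsub>M\<^esub> x = \<zero>\<^bsub>M\<^esub>" by blast
  qed (unfold car, auto simp: hom L.a_ac)
  interpret M: abelian_group M by (rule ag)
  have neg: "\<ominus>\<^bsub>M\<^esub> f x = f (\<ominus>\<^bsub>L\<^esub> x)" if "x \<in> carrier L" for x
    by (rule M.minus_equality) (use that car in \<open>auto simp: hom L.l_neg\<close>)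
  have mod: "Module.module class_field M"
  proof (rule moduleI)
  qed (use cring_class_field ag in \<open>auto simp: car hom closed L.smult_l_distr[simplified]
    L.smult_r_distr[simplified] L.smult_assoc1[simplified] L.smult_one[simplified]\<close>)
  interpret M: Module.module class_field M by (rule mod)
  show ?thesis
  proof
    fix x y assume xy: "x \<in> carrier M" "y \<in> carrier M"
    then obtain a b where ab: "a \<in> carrier L" "b \<in> carrier L" "x = f a" "y = f b"
      using car by auto
    \<comment> \<open>A map of \<open>M\<close> that \<open>f\<close> intertwines with a linear map
      of \<open>L\<close> is itself linear; this settles all three slots of the bracket.\<close>
    have transfer: "h \<in> linear_maps M M"
      if g: "g \<in> linear_maps L L" and h: "\<And>c. c \<in> carrier L \<Longrightarrow> h (f c) = f (g c)" for g h
      using g unfolding linear_maps_def car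
      by (simp add: Pi_iff h hom L.a_closed smc)
    show "(\<lambda>z. bracket M z x y) \<in> linear_maps M M"
      by (rule transfer[OF L.bracket_linear1[OF ab(1,2)]]) (simp add: ab hom)
    show "(\<lambda>z. bracket M x z y) \<in> linear_maps M M"
      by (rule transfer[OF L.bracket_linear2[OF ab(1,2)]]) (simp add: ab hom)
    show "(\<lambda>z. bracket M x y z) \<in> linear_maps M M"
      by (rule transfer[OF L.bracket_linear3[OF ab(1,2)]]) (simp add: ab hom)
  next
    fix x y z assume "x \<in> carrier M" "y \<in> carrier M" "z \<in> carrier M"
    then obtain a b c where abc: "x = f a" "y = f b" "z = f c"
      "a \<in> carrier L" "b \<in> carrier L" "c \<in> carrier L"
      by (auto simp: car)
    show "bracket M y x z = \<ominus>\<^bsub>M\<^esub> bracket M x y z"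
      using L.bracket_skew12[OF abc(4-6)] by (simp add: abc br[symmetric] neg brc)
    show "bracket M x z y = \<ominus>\<^bsub>M\<^esub> bracket M x y z"
      using L.bracket_skew23[OF abc(4-6)] by (simp add: abc br[symmetric] neg brc)
  next
    fix x1 x2 x3 x4 x5
    assume "x1 \<in> carrier M" "x2 \<in> carrier M" "x3 \<in> carrier M" "x4 \<in> carrier M" "x5 \<in> carrier M"
    then obtain a1 a2 a3 a4 a5 where a: "x1 = f a1" "x2 = f a2" "x3 = f a3" "x4 = f a4" "x5 = f a5"
      "a1 \<in> carrier L" "a2 \<in> carrier L" "a3 \<in> carrier L" "a4 \<in> carrier L" "a5 \<in> carrier L"
      by (auto simp: car)
    show "bracket M x1 x2 (bracket M x3 x4 x5) =
      bracket M (bracket M x1 x2 x3) x4 x5 \<oplus>\<^bsub>M\<^esub> bracket M x3 (bracket M x1 x2 x4) x5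
        \<oplus>\<^bsub>M\<^esub> bracket M x3 x4 (bracket M x1 x2 x5)"
      using L.fundamental_identity[OF a(6-10)] by (simp add: a hom closed)
  qed
qed

section \<open>Isomorphism of extensions\<close>

lemma linear_mapsD:
  assumes "f \<in> linear_maps L M"
  shows "x \<in> carrier L \<Longrightarrow> f x \<in> carrier M"
    and "x \<in> carrier L \<Longrightarrow> y \<in> carrier L \<Longrightarrow> f (x \<oplus>\<^bsub>L\<^esub> y) = f x \<oplus>\<^bsub>M\<^esub> f y"
    and "x \<in> carrier L \<Longrightarrow> f (c \<odot>\<^bsub>L\<^esub> x) = c \<odot>\<^bsub>M\<^esub> f x"
  using assms unfolding linear_maps_def by blast+

lemma (in abelian_group) minus_eq_zero_iff:
  assumes "x \<in> carrier G" "y \<in> carrier G"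
  shows "x \<ominus> y = \<zero> \<longleftrightarrow> x = y"
  using assms by (metis a_minus_def add.inv_closed minus_equality minus_minus r_neg)

lemma linear_maps_zero:
  assumes "three_lie_algebra L" "three_lie_algebra M" "f \<in> linear_maps L M"
  shows "f \<zero>\<^bsub>L\<^esub> = \<zero>\<^bsub>M\<^esub>"
proof -
  interpret L: three_lie_algebra L by fact
  interpret M: three_lie_algebra M by fact
  note f = linear_mapsD[OF assms(3)]
  have "f \<zero>\<^bsub>L\<^esub> \<oplus>\<^bsub>M\<^esub> f \<zero>\<^bsub>L\<^esub> = f \<zero>\<^bsub>L\<^esub>"
    using f(2)[of "\<zero>\<^bsub>L\<^esub>" "\<zero>\<^bsub>L\<^esub>"] by simp
  then show ?thesis
    using f(1)[of "\<zero>\<^bsub>L\<^esub>"] by (simp add: M.add.l_cancel_one')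
qed

lemma linear_maps_minus:
  assumes "three_lie_algebra L" "three_lie_algebra M" "f \<in> linear_maps L M"
    "x \<in> carrier L" "y \<in> carrier L"
  shows "f (x \<ominus>\<^bsub>L\<^esub> y) = f x \<ominus>\<^bsub>M\<^esub> f y"
proof -
  interpret L: three_lie_algebra L by fact
  interpret M: three_lie_algebra M by fact
  note f = linear_mapsD[OF assms(3)]
  have "f (\<ominus>\<^bsub>L\<^esub> y) \<oplus>\<^bsub>M\<^esub> f y = \<zero>\<^bsub>M\<^esub>"
    using f(2)[of "\<ominus>\<^bsub>L\<^esub> y" y] assms linear_maps_zero[OF assms(1-3)] by (simp add: L.l_neg)
  then have "f (\<ominus>\<^bsub>L\<^esub> y) = \<ominus>\<^bsub>M\<^esub> f y"
    using M.minus_equality[of "f (\<ominus>\<^bsub>L\<^esub> y)" "f y"] f(1) assms by simp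
  then show ?thesis
    using f assms by (simp add: a_minus_def)
qed

lemma three_lie_algebra_bracket_closed:
  assumes "three_lie_algebra L" "x \<in> carrier L" "y \<in> carrier L" "z \<in> carrier L"
  shows "bracket L x y z \<in> carrier L"
  using linear_mapsD(1)[OF three_lie_algebra.bracket_linear1[OF assms(1,3,4)] assms(2)] .

lemma ext_isomorphic_refl: "ext_isomorphic H X X"
  unfolding ext_isomorphic_def
  by (rule bexI[of _ "\<lambda>x. x"]) (auto simp: three_lie_morphisms_def linear_maps_def)

lemma ext_isomorphic_trans:
  assumes "ext_isomorphic H X1 X2" "ext_isomorphic H X2 X3"
  shows "ext_isomorphic H X1 X3"
proof -
  from assms obtain \<theta> \<eta> where
    \<theta>: "\<theta> \<in> three_lie_morphisms (middle X2) (middle X1)"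
      "\<forall>u \<in> carrier H. \<theta> (incl X2 u) = incl X1 u"
      "\<forall>x \<in> carrier (middle X2). proj X1 (\<theta> x) = proj X2 x"
    and \<eta>: "\<eta> \<in> three_lie_morphisms (middle X3) (middle X2)"
      "\<forall>u \<in> carrier H. \<eta> (incl X3 u) = incl X2 u"
      "\<forall>x \<in> carrier (middle X3). proj X2 (\<eta> x) = proj X3 x"
    unfolding ext_isomorphic_def by blast
  have "\<theta> \<circ> \<eta> \<in> three_lie_morphisms (middle X3) (middle X1)"
    using \<theta>(1) \<eta>(1) by (simp add: three_lie_morphisms_def linear_maps_def Pi_iff)
  then show ?thesis
    unfolding ext_isomorphic_def
    by (rule bexI[rotated]) (use \<theta> \<eta> in \<open>auto simp: three_lie_morphisms_def linear_maps_def Pi_iff\<close>)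
qed

lemma extensionsD:
  assumes "X \<in> extensions G H"
  shows "three_lie_algebra (middle X)" "incl X \<in> three_lie_morphisms H (middle X)"
    "proj X \<in> three_lie_morphisms (middle X) G" "inj_on (incl X) (carrier H)"
    "incl X ` carrier H = {x \<in> carrier (middle X). proj X x = \<zero>\<^bsub>G\<^esub>}"
    "proj X ` carrier (middle X) = carrier G"
    "incl X \<in> linear_maps H (middle X)" "proj X \<in> linear_maps (middle X) G"
  using assms by (auto simp: extensions_def three_lie_morphisms_def)

text \<open>Injectivity: if two elements have the same image, their difference projects to zero, so
  it comes from \<open>H\<close>, and there it vanishes because \<open>incl X1\<close> is injective.
  Surjectivity: lift \<open>proj X1 y\<close> to the second extension; the remaining error is in the
  image of \<open>incl X1\<close>, which \<open>\<theta>\<close> reaches through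
  \<open>incl X2\<close>.\<close>

lemma ext_short_five_lemma:
  assumes G: "three_lie_algebra G" and H: "three_lie_algebra H"
    and X1: "X1 \<in> extensions G H" and X2: "X2 \<in> extensions G H"
    and \<theta>: "\<theta> \<in> linear_maps (middle X2) (middle X1)"
      "\<And>u. u \<in> carrier H \<Longrightarrow> \<theta> (incl X2 u) = incl X1 u"
      "\<And>x. x \<in> carrier (middle X2) \<Longrightarrow> proj X1 (\<theta> x) = proj X2 x"
  shows "bij_betw \<theta> (carrier (middle X2)) (carrier (middle X1))"
proof -
  note E1 = extensionsD[OF X1] and E2 = extensionsD[OF X2]
  interpret M1: three_lie_algebra "middle X1" by (rule E1)
  interpret M2: three_lie_algebra "middle X2" by (rule E2)
  interpret G: three_lie_algebra G by (rule G)
  interpret H: three_lie_algebra H by (rule H)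
  note cl = linear_mapsD(1)[OF \<theta>(1)] linear_mapsD(1)[OF E1(7)] linear_mapsD(1)[OF E1(8)]
    linear_mapsD(1)[OF E2(7)] linear_mapsD(1)[OF E2(8)]
  show ?thesis
    unfolding bij_betw_def
  proof (intro conjI inj_onI equalityI subsetI)
    fix a b assume ab: "a \<in> carrier (middle X2)" "b \<in> carrier (middle X2)" "\<theta> a = \<theta> b"
    define d where "d = a \<ominus>\<^bsub>middle X2\<^esub> b"
    have d: "d \<in> carrier (middle X2)" using ab by (simp add: d_def)
    have td: "\<theta> d = \<zero>\<^bsub>middle X1\<^esub>"
      using linear_maps_minus[OF E2(1) E1(1) \<theta>(1) ab(1,2)] ab cl by (simp add: d_def M1.minus_eq_zero_iff)
    then have "proj X2 d = \<zero>\<^bsub>G\<^esub>"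
      using \<theta>(3)[OF d] linear_maps_zero[OF E1(1) G E1(8)] by simp
    then obtain u where u: "u \<in> carrier H" "d = incl X2 u" using E2(5) d by blast
    have "incl X1 u = incl X1 \<zero>\<^bsub>H\<^esub>"
      using \<theta>(2)[OF u(1)] u(2) td linear_maps_zero[OF H E1(1) E1(7)] by simp
    then have "u = \<zero>\<^bsub>H\<^esub>" using E1(4) u(1) by (simp add: inj_on_eq_iff)
    then have "d = \<zero>\<^bsub>middle X2\<^esub>" using u(2) linear_maps_zero[OF H E2(1) E2(7)] by simp
    then show "a = b" using ab by (simp add: d_def M2.minus_eq_zero_iff)
  next
    fix y assume "y \<in> \<theta> ` carrier (middle X2)"
    then show "y \<in> carrier (middle X1)" using cl by auto
  next
    fix y assume y: "y \<in> carrier (middle X1)"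
    then have "proj X1 y \<in> proj X2 ` carrier (middle X2)" using E2(6) cl by simp
    then obtain x where x: "x \<in> carrier (middle X2)" "proj X2 x = proj X1 y" by auto
    have "proj X1 (y \<ominus>\<^bsub>middle X1\<^esub> \<theta> x) = \<zero>\<^bsub>G\<^esub>"
      using linear_maps_minus[OF E1(1) G E1(8) y cl(1)[OF x(1)]] \<theta>(3)[OF x(1)] x y cl
      by (simp add: G.minus_eq_zero_iff)
    then have "y \<ominus>\<^bsub>middle X1\<^esub> \<theta> x \<in> incl X1 ` carrier H"
      unfolding E1(5) using M1.minus_closed[OF y cl(1)[OF x(1)]] by simp
    then obtain u where u: "u \<in> carrier H" "y \<ominus>\<^bsub>middle X1\<^esub> \<theta> x = incl X1 u" by blast
    have "y = (y \<ominus>\<^bsub>middle X1\<^esub> \<theta> x) \<oplus>\<^bsub>middle X1\<^esub> \<theta> x"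
      using y cl(1)[OF x(1)] by (simp add: a_minus_def M1.a_assoc M1.l_neg)
    also have "\<dots> = \<theta> (incl X2 u \<oplus>\<^bsub>middle X2\<^esub> x)"
      using u \<theta>(2)[OF u(1)] linear_mapsD(2)[OF \<theta>(1)] x cl by simp
    finally show "y \<in> \<theta> ` carrier (middle X2)"
      using x u cl by simp
  qed
qed

text \<open>An isomorphism of extensions is defined as a mere morphism in one direction. The short
  five lemma makes it bijective, and its inverse is again a morphism compatible with injections and
  projections.\<close>

lemma ext_isomorphic_sym:
  assumes G: "three_lie_algebra G" and H: "three_lie_algebra H"
    and X1: "X1 \<in> extensions G H" and X2: "X2 \<in> extensions G H"
    and iso: "ext_isomorphic H X1 X2"
  shows "ext_isomorphic H X2 X1"
proof -
  from iso obtain \<theta> where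
    \<theta>: "\<theta> \<in> three_lie_morphisms (middle X2) (middle X1)"
      "\<And>u. u \<in> carrier H \<Longrightarrow> \<theta> (incl X2 u) = incl X1 u"
      "\<And>x. x \<in> carrier (middle X2) \<Longrightarrow> proj X1 (\<theta> x) = proj X2 x"
    unfolding ext_isomorphic_def by blast
  then have lin: "\<theta> \<in> linear_maps (middle X2) (middle X1)"
    and br: "\<And>x y z. x \<in> carrier (middle X2) \<Longrightarrow> y \<in> carrier (middle X2) \<Longrightarrow>
      z \<in> carrier (middle X2) \<Longrightarrow>
      \<theta> (bracket (middle X2) x y z) = bracket (middle X1) (\<theta> x) (\<theta> y) (\<theta> z)"
    by (auto simp: three_lie_morphisms_def)
  note E1 = extensionsD[OF X1] and E2 = extensionsD[OF X2]
  interpret M2: three_lie_algebra "middle X2" by (rule E2)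
  have bij: "bij_betw \<theta> (carrier (middle X2)) (carrier (middle X1))"
    by (rule ext_short_five_lemma[OF G H X1 X2 lin \<theta>(2,3)])
  define \<eta> where "\<eta> = inv_into (carrier (middle X2)) \<theta>"
  have \<eta>_cl: "\<eta> y \<in> carrier (middle X2)" and \<theta>\<eta>: "\<theta> (\<eta> y) = y" if "y \<in> carrier (middle X1)" for y
    using that bij unfolding \<eta>_def by (auto simp: bij_betw_def inv_into_into f_inv_into_f)
  \<comment> \<open>With this rule, each preservation law for \<open>\<eta>\<close> reduces to the
    same law for \<open>\<theta>\<close>.\<close>
  have \<eta>_eq: "\<eta> y = x" if "x \<in> carrier (middle X2)" "y = \<theta> x" for x y
    using that bij unfolding \<eta>_def by (simp add: bij_betw_def)
  have smc: "c \<odot>\<^bsub>middle X2\<^esub> x \<in> carrier (middle X2)" if "x \<in> carrier (middle X2)" for c x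
    using M2.smult_closed that by simp
  have "\<eta> \<in> three_lie_morphisms (middle X1) (middle X2)"
    unfolding three_lie_morphisms_def linear_maps_def
    by (auto intro!: \<eta>_eq simp: \<eta>_cl \<theta>\<eta> smc linear_mapsD[OF lin] br
        three_lie_algebra_bracket_closed[OF E2(1)])
  moreover have "\<eta> (incl X1 u) = incl X2 u" if "u \<in> carrier H" for u
    using that \<theta>(2) linear_mapsD(1)[OF E2(7)] by (intro \<eta>_eq) auto
  moreover have "proj X2 (\<eta> x) = proj X1 x" if "x \<in> carrier (middle X1)" for x
    using \<theta>(3)[OF \<eta>_cl[OF that]] \<theta>\<eta>[OF that] by simp
  ultimately show ?thesis
    unfolding ext_isomorphic_def by blast
qed

lemma equiv_ext_rel:
  assumes "three_lie_algebra G" "three_lie_algebra H"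
  shows "equiv (extensions G H) (ext_rel G H)"
proof (rule equivI)
  show "refl_on (extensions G H) (ext_rel G H)"
    by (simp add: refl_on_def ext_rel_def ext_isomorphic_refl)
  show "sym (ext_rel G H)"
    unfolding sym_def ext_rel_def using ext_isomorphic_sym[OF assms] by blast
  show "trans (ext_rel G H)"
    unfolding trans_def ext_rel_def using ext_isomorphic_trans by blast
qed (auto simp: ext_rel_def)

text \<open>A class is sent to the set of all elements of \<open>B\<close> related to one of its
  members, so no representatives are chosen. The assumptions on \<open>left\<close> and
  \<open>right\<close> make this set exactly one class of \<open>s\<close>, and make distinct
  classes of \<open>r\<close> go to distinct ones. The second conjunct determines \<open>F\<close>
  on the quotient by \<open>R\<close>.\<close>

lemma quotient_bij_betw:
  assumes A: "equiv A r" and B: "equiv B s"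
    and ex1: "\<And>a. a \<in> A \<Longrightarrow> \<exists>b\<in>B. R a b" and ex2: "\<And>b. b \<in> B \<Longrightarrow> \<exists>a\<in>A. R a b"
    and left: "\<And>a a' b. a \<in> A \<Longrightarrow> a' \<in> A \<Longrightarrow> b \<in> B \<Longrightarrow> R a b \<Longrightarrow> R a' b \<longleftrightarrow> (a, a') \<in> r"
    and right: "\<And>a b b'. a \<in> A \<Longrightarrow> b \<in> B \<Longrightarrow> b' \<in> B \<Longrightarrow> R a b \<Longrightarrow> R a b' \<longleftrightarrow> (b, b') \<in> s"
  shows "\<exists>F. bij_betw F (A // r) (B // s) \<and> (\<forall>a\<in>A. \<forall>b\<in>B. F (r `` {a}) = s `` {b} \<longleftrightarrow> R a b)"
proof -
  define F where "F C = {b \<in> B. \<exists>a\<in>C. R a b}" for C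
  have rep: "F (r `` {a}) = s `` {b}" if "a \<in> A" "b \<in> B" "R a b" for a b
  proof -
    have sub: "r `` {a} \<subseteq> A" "a \<in> r `` {a}" "s `` {b} \<subseteq> B"
      using A B that by (auto simp: equiv_def refl_on_def)
    have "(\<exists>a'\<in>r `` {a}. R a' b') \<longleftrightarrow> R a b'" if b': "b' \<in> B" for b'
    proof
      assume "\<exists>a'\<in>r `` {a}. R a' b'"
      then obtain a' where a': "(a, a') \<in> r" "a' \<in> A" "R a' b'" using sub by blast
      then have "(a', a) \<in> r" using A by (meson equivE symE)
      then show "R a b'" using left[OF a'(2) \<open>a \<in> A\<close> b' a'(3)] by simp
    qed (use sub in blast)
    then show ?thesis
      using right[OF that(1,2) _ that(3)] sub by (auto simp: F_def)
  qed
  have iff: "F (r `` {a}) = s `` {b} \<longleftrightarrow> R a b" if ab: "a \<in> A" "b \<in> B" for a b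
  proof
    assume eq: "F (r `` {a}) = s `` {b}"
    have "b \<in> s `` {b}" using B ab by (auto simp: equiv_def refl_on_def)
    moreover obtain b' where b': "b' \<in> B" "R a b'" using ex1 ab by blast
    ultimately have "(b', b) \<in> s" using rep[OF ab(1) b'] eq by auto
    then show "R a b" using right[OF ab(1) b'(1) ab(2) b'(2)] by simp
  qed (use rep ab in blast)
  have "bij_betw F (A // r) (B // s)"
  proof (rule bij_betw_imageI)
    show "inj_on F (A // r)"
    proof (rule inj_onI)
      fix C D assume "C \<in> A // r" "D \<in> A // r" and eq: "F C = F D"
      then obtain c d where c: "c \<in> A" "C = r `` {c}" and d: "d \<in> A" "D = r `` {d}"
        by (auto elim!: quotientE)
      obtain b where b: "b \<in> B" "R c b" using ex1 c by blast
      then have "R d b" using rep[OF c(1) b] iff[OF d(1) b(1)] eq c d by simp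
      then show "C = D" using left[OF c(1) d(1) b] equiv_class_eq[OF A] c d by simp
    qed
    show "F ` (A // r) = B // s"
    proof (intro equalityI subsetI)
      fix D assume "D \<in> F ` (A // r)"
      then obtain a where "a \<in> A" "D = F (r `` {a})" by (auto elim!: quotientE)
      moreover obtain b where "b \<in> B" "R a b" using ex1 \<open>a \<in> A\<close> by blast
      ultimately show "D \<in> B // s" using rep by (simp add: quotientI)
    next
      fix D assume "D \<in> B // s"
      then obtain b where b: "b \<in> B" "D = s `` {b}" by (auto elim!: quotientE)
      obtain a where a: "a \<in> A" "R a b" using ex2 b by blast
      have "F (r `` {a}) = D" using rep[OF a(1) b(1) a(2)] b by simp
      then show "D \<in> F ` (A // r)" using quotientI[OF a(1)] by blast
    qed
  qed
  with iff show ?thesis by blast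
qed

section \<open>Cochains of degree at most one\<close>

text \<open>The counterpart of \<open>cochain_of_bracket\<close> in degree 0; the default 0 on
  nonempty lists is the convention of \<open>cochains\<close>.\<close>

definition cochain_of_map :: "('v \<Rightarrow> 'v) \<Rightarrow> 'v::ab_group_add cochain" where
  "cochain_of_map \<phi> = (\<lambda>Xs x. if Xs = [] then \<phi> x else 0)"

lemma cochain_of_bracket_simps [simp]:
  "cochain_of_bracket f [] z = 0" "cochain_of_bracket f [X] z = f (fst X) (snd X) z"
  "cochain_of_bracket f (X # Y # Xs) z = 0"
  by (simp_all add: cochain_of_bracket_def split: prod.split)

lemma cochain_of_bracket_eq:
  "cochain_of_bracket f Xs z = (if length Xs = 1 then f (fst (hd Xs)) (snd (hd Xs)) z else 0)"
  by (auto simp: cochain_of_bracket_def split: list.split)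

lemma cochain_of_bracket_arith:
  "cochain_of_bracket f + cochain_of_bracket g = cochain_of_bracket (\<lambda>x y z. f x y z + g x y z)"
  "cochain_of_bracket f - cochain_of_bracket g = cochain_of_bracket (\<lambda>x y z. f x y z - g x y z)"
  "cochain_of_bracket (\<lambda>x y z. 0) = 0"
  by (auto simp: fun_eq_iff cochain_of_bracket_def split: list.split)

lemma cochain_scale_cochain_of_bracket:
  assumes "vector_space s"
  shows "cochain_scale s c (cochain_of_bracket f) = cochain_of_bracket (\<lambda>x y z. s c (f x y z))"
proof -
  interpret vector_space s by fact
  show ?thesis
    by (auto simp: fun_eq_iff cochain_scale_def cochain_of_bracket_def split: list.split)
qed

lemma cochain_of_bracket_eq_iff [simp]:
  "cochain_of_bracket f = cochain_of_bracket g \<longleftrightarrow> f = g"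
proof
  assume "cochain_of_bracket f = cochain_of_bracket g"
  then have "cochain_of_bracket f [(x, y)] z = cochain_of_bracket g [(x, y)] z" for x y z by simp
  then show "f = g" by (simp add: fun_eq_iff)
qed simp

lemma all_length_1: "(\<forall>Xs. length Xs = Suc 0 \<longrightarrow> P Xs) \<longleftrightarrow> (\<forall>x y. P [(x, y)])"
  by (metis length_Suc_conv length_0_conv surj_pair)

lemma cochains_0: "cochains s 0 = cochain_of_map ` {\<phi>. Vector_Spaces.linear s s \<phi>}"
proof (intro equalityI subsetI)
  fix \<alpha> assume \<alpha>: "\<alpha> \<in> cochains s 0"
  then have "\<alpha> = cochain_of_map (\<alpha> [])"
    by (auto simp: cochains_def cochain_of_map_def fun_eq_iff)
  moreover have "Vector_Spaces.linear s s (\<alpha> [])" using \<alpha> by (simp add: cochains_def)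
  ultimately show "\<alpha> \<in> cochain_of_map ` {\<phi>. Vector_Spaces.linear s s \<phi>}" by blast
next
  fix \<alpha> assume "\<alpha> \<in> cochain_of_map ` {\<phi>. Vector_Spaces.linear s s \<phi>}"
  then obtain \<phi> where "Vector_Spaces.linear s s \<phi>" "\<alpha> = cochain_of_map \<phi>" by blast
  then show "\<alpha> \<in> cochains s 0"
    by (simp add: cochains_def cochain_of_map_def)
qed

text \<open>In degree 1, one skew condition of \<open>cochains\<close> swaps the two entries of the
  only pair, the other swaps its second entry with the last argument. These are the two
  transpositions in \<open>alternating3\<close>.\<close>

lemma cochains_1: "cochains s 1 = cochain_of_bracket ` {f. alternating3 s f}"
proof -
  have iff: "\<alpha> \<in> cochains s 1 \<longleftrightarrow> (\<forall>Xs x. length Xs \<noteq> 1 \<longrightarrow> \<alpha> Xs x = 0) \<and>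
      alternating3 s (\<lambda>x y z. \<alpha> [(x, y)] z)" for \<alpha>
    unfolding cochains_def alternating3_def
    by (simp add: all_length_1) blast
  have "\<alpha> \<in> cochains s 1 \<longleftrightarrow> (\<exists>f. alternating3 s f \<and> \<alpha> = cochain_of_bracket f)" for \<alpha>
  proof
    assume "\<alpha> \<in> cochains s 1"
    then have "alternating3 s (\<lambda>x y z. \<alpha> [(x, y)] z)" "\<forall>Xs x. length Xs \<noteq> 1 \<longrightarrow> \<alpha> Xs x = 0"
      using iff by auto
    moreover from this(2) have "\<alpha> = cochain_of_bracket (\<lambda>x y z. \<alpha> [(x, y)] z)"
      by (auto simp: fun_eq_iff cochain_of_bracket_def split: list.split)
    ultimately show "\<exists>f. alternating3 s f \<and> \<alpha> = cochain_of_bracket f" by blast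
  next
    assume "\<exists>f. alternating3 s f \<and> \<alpha> = cochain_of_bracket f"
    then obtain f where f: "alternating3 s f" "\<alpha> = cochain_of_bracket f" by blast
    moreover have "cochain_of_bracket f Xs x = 0" if "length Xs \<noteq> 1" for Xs x
      using that by (auto simp: cochain_of_bracket_def split: list.split)
    ultimately show "\<alpha> \<in> cochains s 1" using iff by simp
  qed
  then show ?thesis by blast
qed

section \<open>Unshuffles, compositions and brackets in low degrees\<close>

lemma unsh_eq_id:
  assumes "i + j \<le> 1"
  shows "unsh i j = {id}"
proof -
  have "\<sigma> permutes {..<i + j} \<longleftrightarrow> \<sigma> = id" for \<sigma>
  proof (cases "i + j = 0")
    case False
    then have "{..<i + j} = {0}" using assms by auto
    then show ?thesis by simp
  qed simp
  then show ?thesis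
    by (auto simp: unsh_def strict_mono_on_def)
qed

text \<open>Both monotonicity conditions concern singletons, so every permutation of two positions
  qualifies.\<close>

lemma unsh_1_1: "unsh 1 1 = {id, transpose 0 1}"
proof -
  have "{..<1 + 1} = {0, 1 :: nat}" by auto
  then show ?thesis
    by (auto simp: unsh_def permutes_doubleton_iff strict_mono_on_def)
qed

text \<open>The first two terms come from \<open>k = 0\<close>, with the identity as only unshuffle.
  The last two come from the two (1,1)-unshuffles: the prefactor -1 makes the identity contribute
  with sign minus and the transposition with sign plus. For \<open>f = g\<close> the result is the
  defect of the fundamental identity.\<close>

lemma circ_1_1:
  assumes "vector_space s"
  shows "circ s 1 1 (cochain_of_bracket f) (cochain_of_bracket g) Xs x =
    (case Xs of [(x1, x2), (x3, x4)] \<Rightarrow>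
       f (g x1 x2 x3) x4 x + f x3 (g x1 x2 x4) x - f x1 x2 (g x3 x4 x) + f x3 x4 (g x1 x2 x)
     | _ \<Rightarrow> 0)"
proof -
  interpret vector_space s by fact
  \<comment> \<open>Lets the sum over the set of these two unshuffles split into two terms.\<close>
  have ne: "id \<noteq> transpose 0 (1 :: nat)"
    by (metis id_apply transpose_apply_first zero_neq_one)
  have "circ s 1 1 (cochain_of_bracket f) (cochain_of_bracket g) [(x1, x2), (x3, x4)] x =
      f (g x1 x2 x3) x4 x + f x3 (g x1 x2 x4) x - f x1 x2 (g x3 x4 x) + f x3 x4 (g x1 x2 x)"
    for x1 x2 x3 x4
    using ne unfolding circ_def unsh_1_1 by (simp add: unsh_eq_id sign_swap_id algebra_simps)
  then show ?thesis
    by (auto simp: circ_def split: list.split)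
qed

text \<open>The composition of \<open>f\<close> in degree 1 with \<open>\<phi>\<close> in degree
  0.\<close>

definition insertion :: "('v \<Rightarrow> 'v) \<Rightarrow> ('v \<Rightarrow> 'v \<Rightarrow> 'v \<Rightarrow> 'v) \<Rightarrow> 'v \<Rightarrow> 'v \<Rightarrow> 'v \<Rightarrow> 'v::ab_group_add" where
  "insertion \<phi> f = (\<lambda>x y z. f (\<phi> x) y z + f x (\<phi> y) z + f x y (\<phi> z))"

lemma circ_0_1:
  assumes "vector_space s" "\<phi> 0 = 0"
  shows "circ s 0 1 (cochain_of_map \<phi>) (cochain_of_bracket f) =
    cochain_of_bracket (\<lambda>x y z. \<phi> (f x y z))"
proof (intro ext)
  interpret vector_space s by fact
  fix Xs x
  show "circ s 0 1 (cochain_of_map \<phi>) (cochain_of_bracket f) Xs x =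
    cochain_of_bracket (\<lambda>x y z. \<phi> (f x y z)) Xs x"
  proof (cases "length Xs = 1")
    case True
    then obtain X where "Xs = [X]" by (auto simp: length_Suc_conv)
    then show ?thesis
      by (simp add: circ_def cochain_of_map_def unsh_eq_id)
  next
    case False
    then show ?thesis
      by (auto simp: circ_def cochain_of_bracket_def split: list.split)
  qed
qed

lemma circ_1_0:
  assumes "vector_space s"
  shows "circ s 1 0 (cochain_of_bracket f) (cochain_of_map \<phi>) = cochain_of_bracket (insertion \<phi> f)"
proof (intro ext)
  interpret vector_space s by fact
  fix Xs x
  show "circ s 1 0 (cochain_of_bracket f) (cochain_of_map \<phi>) Xs x =
    cochain_of_bracket (insertion \<phi> f) Xs x"
  proof (cases "length Xs = 1")
    case True
    then obtain a b where "Xs = [(a, b)]" by (auto simp: length_Suc_conv)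
    then show ?thesis
      by (simp add: circ_def cochain_of_map_def unsh_eq_id insertion_def)
  next
    case False
    then show ?thesis
      by (auto simp: circ_def cochain_of_bracket_def split: list.split)
  qed
qed

text \<open>A factor of degree 0 produces no sign, so this is a plain commutator: the defect of
  \<open>\<phi>\<close> as a derivation of \<open>f\<close>.\<close>

lemma bracket_3Lie_0_1:
  assumes "vector_space s" "\<phi> 0 = 0"
  shows "bracket_3Lie s 0 1 (cochain_of_map \<phi>) (cochain_of_bracket f) =
    cochain_of_bracket (\<lambda>x y z. \<phi> (f x y z) - insertion \<phi> f x y z)"
proof -
  interpret vector_space s by fact
  show ?thesis
    using assms by (simp add: bracket_3Lie_def circ_0_1[simplified] circ_1_0[simplified]
      cochain_scale_cochain_of_bracket cochain_of_bracket_arith)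
qed

lemma bracket_3Lie_1_0:
  assumes "vector_space s" "\<phi> 0 = 0"
  shows "bracket_3Lie s 1 0 (cochain_of_bracket f) (cochain_of_map \<phi>) =
    cochain_of_bracket (\<lambda>x y z. insertion \<phi> f x y z - \<phi> (f x y z))"
proof -
  interpret vector_space s by fact
  show ?thesis
    using assms by (simp add: bracket_3Lie_def circ_0_1[simplified] circ_1_0[simplified]
      cochain_scale_cochain_of_bracket cochain_of_bracket_arith)
qed

section \<open>Maurer-Cartan elements as extensions on the direct sum\<close>

lemma alternating3_skew:
  assumes "alternating3 s f"
  shows "f y x z = - f x y z" "f x z y = - f x y z"
  using assms unfolding alternating3_def by blast+

lemma alternating3_linear:
  assumes "alternating3 s f"
  shows "Vector_Spaces.linear s s (\<lambda>x. f x y z)" "Vector_Spaces.linear s s (\<lambda>x. f y x z)"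
    "Vector_Spaces.linear s s (f y z)"
  using assms unfolding alternating3_def by blast+

lemma alternating3_add:
  assumes f: "alternating3 s f" and g: "alternating3 s g"
  shows "alternating3 s (\<lambda>x y z. f x y z + g x y z)"
proof -
  interpret f: Vector_Spaces.linear s s "f 0 0" using f unfolding alternating3_def by blast
  interpret vector_space_pair s s ..
  have "f y x z + g y x z = - (f x y z + g x y z)"
    "f x z y + g x z y = - (f x y z + g x y z)" for x y z
    by (simp_all add: alternating3_skew[OF f, where x=x and y=y and z=z] alternating3_skew[OF g, where x=x and y=y and z=z])
  note skew = this
  show ?thesis
    unfolding alternating3_def
    by (intro conjI allI linear_compose_add alternating3_linear[OF f] alternating3_linear[OF g] skew)
qed

lemma alternating3_diff:
  assumes f: "alternating3 s f" and g: "alternating3 s g"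
  shows "alternating3 s (\<lambda>x y z. f x y z - g x y z)"
proof -
  interpret f: Vector_Spaces.linear s s "f 0 0" using f unfolding alternating3_def by blast
  interpret vector_space_pair s s ..
  have "f y x z - g y x z = - (f x y z - g x y z)"
    "f x z y - g x z y = - (f x y z - g x y z)" for x y z
    by (simp_all add: alternating3_skew[OF f, where x=x and y=y and z=z] alternating3_skew[OF g, where x=x and y=y and z=z])
  note skew = this
  show ?thesis
    unfolding alternating3_def
    by (intro conjI allI linear_compose_sub alternating3_linear[OF f] alternating3_linear[OF g] skew)
qed

lemma dgla_gt_simps [simp]:
  "dg_part (dgla_gt sg sh bg bh) = cochains_gt (module_prod.scale sg sh)"
  "dg_scale (dgla_gt sg sh bg bh) = cochain_scale (module_prod.scale sg sh)"
  "dg_bracket (dgla_gt sg sh bg bh) = bracket_3Lie (module_prod.scale sg sh)"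
  "dg_diff (dgla_gt sg sh bg bh) p =
    bracket_3Lie (module_prod.scale sg sh) 1 p (cochain_of_bracket (sum_bracket bg bh))"
  by (simp_all add: dgla_gt_def Let_def)

section \<open>The two given algebras and their direct sum\<close>

locale three_lie_pair =
  fixes sg :: "'k::field_char_0 \<Rightarrow> 'g::ab_group_add \<Rightarrow> 'g"
    and sh :: "'k \<Rightarrow> 'h::ab_group_add \<Rightarrow> 'h"
    and bg :: "'g \<Rightarrow> 'g \<Rightarrow> 'g \<Rightarrow> 'g"
    and bh :: "'h \<Rightarrow> 'h \<Rightarrow> 'h \<Rightarrow> 'h"
  assumes three_lie_G: "three_lie_algebra (type_algebra3 sg bg)"
    and three_lie_H: "three_lie_algebra (type_algebra3 sh bh)"
begin

abbreviation "G \<equiv> type_algebra3 sg bg"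
abbreviation "H \<equiv> type_algebra3 sh bh"
abbreviation "L \<equiv> dgla_gt sg sh bg bh"
abbreviation "sgh \<equiv> module_prod.scale sg sh"
abbreviation "\<mu> \<equiv> sum_bracket bg bh"
abbreviation "split_ext p \<equiv> mc_extension sg sh bg bh (cochain_of_bracket p)"

lemma alternating3_bg: "alternating3 sg bg" and filippov_bg: "filippov bg"
  and alternating3_bh: "alternating3 sh bh" and filippov_bh: "filippov bh"
  using three_lie_G three_lie_H by (auto simp: three_lie_algebra_type_algebra3_iff)

sublocale vg: vector_space sg
  using three_lie_G by (simp add: three_lie_algebra_type_algebra3_iff)

sublocale vh: vector_space sh
  using three_lie_H by (simp add: three_lie_algebra_type_algebra3_iff)

sublocale vector_space_prod sg sh ..

lemma vector_space_sgh: "vector_space sgh" ..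

lemma alternating3_sum: "alternating3 sgh \<mu>"
proof -
  note [simp] = alternating3_simps[OF alternating3_bg] alternating3_simps[OF alternating3_bh]
  have "\<mu> y x z = - \<mu> x y z" "\<mu> x z y = - \<mu> x y z" for x y z
    unfolding sum_bracket_def
    by (simp_all add: alternating3_skew[OF alternating3_bg, where x="fst x" and y="fst y" and z="fst z"]
        alternating3_skew[OF alternating3_bh, where x="snd x" and y="snd y" and z="snd z"])
  moreover have "Vector_Spaces.linear sgh sgh (\<lambda>x. \<mu> x y z)"
    "Vector_Spaces.linear sgh sgh (\<lambda>x. \<mu> y x z)" "Vector_Spaces.linear sgh sgh (\<mu> y z)" for y z
    by (simp_all add: Vector_Spaces.linear_iff sum_bracket_def scale_def vector_space_sgh)
  ultimately show ?thesis
    unfolding alternating3_def by blast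
qed

lemma filippov_sum: "filippov \<mu>"
proof -
  have "bg x1 x2 (bg x3 x4 x5) = bg (bg x1 x2 x3) x4 x5 + bg x3 (bg x1 x2 x4) x5 + bg x3 x4 (bg x1 x2 x5)"
    for x1 x2 x3 x4 x5 using filippov_bg unfolding filippov_def by blast
  moreover have
    "bh x1 x2 (bh x3 x4 x5) = bh (bh x1 x2 x3) x4 x5 + bh x3 (bh x1 x2 x4) x5 + bh x3 x4 (bh x1 x2 x5)"
    for x1 x2 x3 x4 x5 using filippov_bh unfolding filippov_def by blast
  ultimately show ?thesis
    unfolding filippov_def sum_bracket_def prod_eq_iff fst_conv snd_conv fst_add snd_add by blast
qed

lemma cochains_gt_1_iff:
  "cochain_of_bracket p \<in> cochains_gt sgh 1 \<longleftrightarrow>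
    alternating3 sgh p \<and> (\<forall>x y z. fst (p x y z) = 0) \<and> (\<forall>u v w. p (0, u) (0, v) (0, w) = 0)"
proof -
  have "(\<forall>Xs x. fst (cochain_of_bracket p Xs x) = 0) \<longleftrightarrow> (\<forall>x y z. fst (p x y z) = 0)"
  proof (intro iffI allI)
    fix x y z
    assume "\<forall>Xs x. fst (cochain_of_bracket p Xs x) = 0"
    from this[rule_format, of "[(x, y)]" z] show "fst (p x y z) = 0" by simp
  qed (auto simp: cochain_of_bracket_eq simp del: split_paired_All)
  moreover have "(\<forall>Xs x. (\<forall>(a, b) \<in> set Xs. fst a = 0 \<and> fst b = 0) \<longrightarrow> fst x = 0 \<longrightarrow>
      cochain_of_bracket p Xs x = 0) \<longleftrightarrow> (\<forall>u v w. p (0, u) (0, v) (0, w) = 0)"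
  proof (intro iffI allI impI)
    fix Xs :: "(('g \<times> 'h) \<times> 'g \<times> 'h) list" and x :: "'g \<times> 'h"
    assume p: "\<forall>u v w. p (0, u) (0, v) (0, w) = 0"
      and "\<forall>(a, b) \<in> set Xs. fst a = 0 \<and> fst b = 0" "fst x = 0"
    then show "cochain_of_bracket p Xs x = 0"
      by (cases x) (auto simp: cochain_of_bracket_def split: list.split)
  next
    fix u v w
    assume "\<forall>Xs x. (\<forall>(a, b) \<in> set Xs. fst a = 0 \<and> fst b = 0) \<longrightarrow> fst x = 0 \<longrightarrow>
      cochain_of_bracket p Xs x = 0"
    from this[rule_format, of "[((0, u), (0, v))]" "(0, w)"] show "p (0, u) (0, v) (0, w) = 0" by simp
  qed
  moreover have "cochain_of_bracket p \<in> cochains sgh 1 \<longleftrightarrow> alternating3 sgh p"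
    by (auto simp: cochains_1[unfolded One_nat_def])
  ultimately show ?thesis
    by (simp add: cochains_gt_def)
qed

text \<open>Since \<mu> \<circ> \<mu> = 0, the Maurer-Cartan expression equals \<pi> \<circ> \<pi>
  for \<pi> = \<mu> + p. On two pairs this is the right side minus the left side of the fundamental
  identity for \<pi>.\<close>

lemma maurer_cartan_iff_filippov:
  assumes p: "alternating3 sgh p"
  shows "dg_diff L 1 (cochain_of_bracket p) + dg_scale L (1 / 2)
      (dg_bracket L 1 1 (cochain_of_bracket p) (cochain_of_bracket p)) = 0
    \<longleftrightarrow> filippov (\<lambda>x y z. \<mu> x y z + p x y z)"
    (is "?M = 0 \<longleftrightarrow> filippov ?\<pi>")
proof -
  have half: "sgh (1 / 2) (a + a) = a" for a
    by (simp flip: p.scale_left_distrib add: p.scale_right_distrib)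
  \<comment> \<open>In degrees (1, 1) the graded commutator is a sum of the two compositions. Hence
    [p, p] is twice p \<circ> p, which cancels the factor 1/2.\<close>
  have M: "?M Xs x = circ sgh 1 1 (cochain_of_bracket \<mu>) (cochain_of_bracket p) Xs x
      + circ sgh 1 1 (cochain_of_bracket p) (cochain_of_bracket \<mu>) Xs x
      + circ sgh 1 1 (cochain_of_bracket p) (cochain_of_bracket p) Xs x" for Xs x
    by (simp add: bracket_3Lie_def cochain_scale_def half)
  have pair: "?M [(x1, x2), (x3, x4)] x5 = 0 \<longleftrightarrow>
      ?\<pi> x1 x2 (?\<pi> x3 x4 x5) = ?\<pi> (?\<pi> x1 x2 x3) x4 x5 + ?\<pi> x3 (?\<pi> x1 x2 x4) x5 + ?\<pi> x3 x4 (?\<pi> x1 x2 x5)"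
    for x1 x2 x3 x4 x5
  proof -
    have fil: "\<mu> x1 x2 (\<mu> x3 x4 x5) =
        \<mu> (\<mu> x1 x2 x3) x4 x5 + \<mu> x3 (\<mu> x1 x2 x4) x5 + \<mu> x3 x4 (\<mu> x1 x2 x5)"
      using filippov_sum unfolding filippov_def by blast
    have "?M [(x1, x2), (x3, x4)] x5 =
        ?\<pi> (?\<pi> x1 x2 x3) x4 x5 + ?\<pi> x3 (?\<pi> x1 x2 x4) x5 + ?\<pi> x3 x4 (?\<pi> x1 x2 x5)
        - ?\<pi> x1 x2 (?\<pi> x3 x4 x5)"
      unfolding M circ_1_1[OF vector_space_sgh]
      by (simp add: alternating3_simps[OF p] alternating3_simps[OF alternating3_sum] fil)
    then show ?thesis
      unfolding right_minus_eq[symmetric, of "?\<pi> x1 x2 (?\<pi> x3 x4 x5)"]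
      by (metis minus_diff_eq neg_equal_0_iff_equal)
  qed
  have other: "?M Xs x = 0" if "\<nexists>X Y. Xs = [X, Y]" for Xs x
    using that unfolding M circ_1_1[OF vector_space_sgh] by (auto split: list.split)
  have "?M = 0 \<longleftrightarrow> (\<forall>x1 x2 x3 x4 x5. ?M [(x1, x2), (x3, x4)] x5 = 0)"
    using other by (auto simp: fun_eq_iff) (metis surj_pair)
  then show ?thesis
    by (simp only: pair filippov_def)
qed

lemma split_ext_simps [simp]:
  "middle (split_ext p) = type_algebra3 sgh (\<lambda>x y z. \<mu> x y z + p x y z)"
  "incl (split_ext p) = Pair 0" "proj (split_ext p) = fst"
  by (auto simp: mc_extension_def)

lemma linear_Pair_0: "Vector_Spaces.linear sh sgh (Pair 0)"
  by (auto simp: Vector_Spaces.linear_iff scale_def vector_space_sgh vh.vector_space_axioms)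

text \<open>Each condition has its own source: alternation and the fundamental identity make the
  middle term a 3-Lie algebra, values in \<hh> make \<open>fst\<close> a morphism, and vanishing on
  \<hh> makes \<open>Pair 0\<close> one. Exactness is automatic. The first three conditions are
  those of \<open>cochains_gt_1_iff\<close>.\<close>

lemma split_ext_in_extensions_iff:
  "split_ext p \<in> extensions G H \<longleftrightarrow>
    alternating3 sgh p \<and> (\<forall>x y z. fst (p x y z) = 0) \<and> (\<forall>u v w. p (0, u) (0, v) (0, w) = 0) \<and>
    filippov (\<lambda>x y z. \<mu> x y z + p x y z)"
proof -
  let ?\<pi> = "\<lambda>x y z. \<mu> x y z + p x y z"
  have "alternating3 sgh ?\<pi> \<longleftrightarrow> alternating3 sgh p"
  proof
    assume "alternating3 sgh ?\<pi>"
    from alternating3_diff[OF this alternating3_sum] show "alternating3 sgh p" by simp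
  qed (rule alternating3_add[OF alternating3_sum])
  then have "three_lie_algebra (type_algebra3 sgh ?\<pi>) \<longleftrightarrow> alternating3 sgh p \<and> filippov ?\<pi>"
    by (simp add: three_lie_algebra_type_algebra3_iff vector_space_sgh)
  moreover have "Pair 0 \<in> three_lie_morphisms H (type_algebra3 sgh ?\<pi>) \<longleftrightarrow>
      (\<forall>u v w. p (0, u) (0, v) (0, w) = 0)"
    using linear_Pair_0 alternating3_simps(13)[OF alternating3_bg]
    by (simp add: three_lie_morphisms_def linear_maps_type_algebra3_iff vector_space_sgh
        vh.vector_space_axioms sum_bracket_def prod_eq_iff)
  moreover have "fst \<in> three_lie_morphisms (type_algebra3 sgh ?\<pi>) G \<longleftrightarrow>
      (\<forall>x y z. fst (p x y z) = 0)"
    using linear_fst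
    by (simp add: three_lie_morphisms_def linear_maps_type_algebra3_iff vector_space_sgh
        vg.vector_space_axioms sum_bracket_def)
  moreover have "range (Pair 0) = {x. fst x = (0 :: 'g)}" by force
  ultimately show ?thesis
    by (auto simp: extensions_def inj_on_def)
qed

lemma MC_iff: "P \<in> MC L \<longleftrightarrow> (\<exists>p. P = cochain_of_bracket p \<and> split_ext p \<in> extensions G H)"
proof -
  have dom: "P \<in> range cochain_of_bracket" if "P \<in> cochains_gt sgh 1"
    using that unfolding cochains_gt_def cochains_1 by blast
  have "cochain_of_bracket p \<in> MC L \<longleftrightarrow> split_ext p \<in> extensions G H" for p
    using cochains_gt_1_iff[of p] maurer_cartan_iff_filippov[of p]
    unfolding MC_def split_ext_in_extensions_iff
    by auto
  moreover have "P \<in> cochains_gt sgh 1" if "P \<in> MC L"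
    using that by (simp add: MC_def)
  ultimately show ?thesis
    using dom by blast
qed

end

section \<open>Gauge equivalence as isomorphism of extensions\<close>

text \<open>An orbit that reaches the fixed point 0 stays there; this truncates the exponential
  series.\<close>

lemma funpow_eq_zero:
  fixes f :: "'a::zero \<Rightarrow> 'a"
  assumes "(f ^^ k) x = 0" "f 0 = 0" "k \<le> n"
  shows "(f ^^ n) x = 0"
proof -
  have "(f ^^ m) 0 = 0" for m by (induction m) (simp_all add: assms(2))
  moreover have "(f ^^ n) x = (f ^^ (n - k)) ((f ^^ k) x)"
    using funpow_add[of "n - k" k f] assms(3) by simp
  ultimately show ?thesis by (simp add: assms(1))
qed

context three_lie_pair
begin

text \<open>For linear \<open>\<phi>\<close> this endomorphism of \<gg> \<oplus> \<hh> squares to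
  zero, and so 1 + \<open>nil \<phi>\<close> has inverse 1 - \<open>nil \<phi>\<close>.\<close>

abbreviation nil :: "('g \<Rightarrow> 'h) \<Rightarrow> 'g \<times> 'h \<Rightarrow> 'g \<times> 'h" where
  "nil \<phi> x \<equiv> (0, \<phi> (fst x))"

text \<open>A linear endomorphism with values in \<hh> that kills \<hh> factors through the
  projection to \<gg>.\<close>

lemma cochains_gt_0: "cochains_gt sgh 0 = (\<lambda>\<phi>. cochain_of_map (nil \<phi>)) ` {\<phi>. Vector_Spaces.linear sg sh \<phi>}"
proof (intro equalityI subsetI)
  fix \<xi> assume "\<xi> \<in> cochains_gt sgh 0"
  then obtain \<psi> where \<psi>: "Vector_Spaces.linear sgh sgh \<psi>" "\<xi> = cochain_of_map \<psi>"
    and fst: "\<And>Xs x. fst (\<xi> Xs x) = 0"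
    and van: "\<And>Xs x. (\<forall>(a, b) \<in> set Xs. fst a = 0 \<and> fst b = 0) \<longrightarrow> fst x = 0 \<longrightarrow> \<xi> Xs x = 0"
    unfolding cochains_gt_def cochains_0 by auto
  interpret \<psi>: Vector_Spaces.linear sgh sgh \<psi> by (rule \<psi>)
  define \<phi> where "\<phi> a = snd (\<psi> (a, 0))" for a
  have f0: "fst (\<psi> x) = 0" for x using fst[of "[]" x] \<psi>(2) by (simp add: cochain_of_map_def)
  have v0: "\<psi> (0, u) = 0" for u using van[of "[]" "(0, u)"] \<psi>(2) by (simp add: cochain_of_map_def)
  have "\<psi> = nil \<phi>"
  proof
    fix x
    have "\<psi> x = \<psi> ((fst x, 0) + (0, snd x))" by simp
    also have "\<dots> = \<psi> (fst x, 0)" unfolding \<psi>.add by (simp add: v0)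
    finally show "\<psi> x = nil \<phi> x" using f0 by (simp add: \<phi>_def prod_eq_iff)
  qed
  moreover have "Vector_Spaces.linear sg sh \<phi>"
    unfolding Vector_Spaces.linear_iff \<phi>_def
    using \<psi>.add[of "(_, 0)" "(_, 0)"] \<psi>.scale[of _ "(_, 0)"]
    by (simp add: vg.vector_space_axioms vh.vector_space_axioms scale_def)
  ultimately show "\<xi> \<in> (\<lambda>\<phi>. cochain_of_map (nil \<phi>)) ` {\<phi>. Vector_Spaces.linear sg sh \<phi>}"
    using \<psi>(2) by auto
next
  fix \<xi> assume "\<xi> \<in> (\<lambda>\<phi>. cochain_of_map (nil \<phi>)) ` {\<phi>. Vector_Spaces.linear sg sh \<phi>}"
  then obtain \<phi> where \<phi>: "Vector_Spaces.linear sg sh \<phi>" "\<xi> = cochain_of_map (nil \<phi>)" by auto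
  interpret \<phi>: Vector_Spaces.linear sg sh \<phi> by (rule \<phi>)
  have "Vector_Spaces.linear sgh sgh (nil \<phi>)"
    by (simp add: Vector_Spaces.linear_iff vector_space_sgh \<phi>.add \<phi>.scale scale_def)
  then have "\<xi> \<in> cochains sgh 0" unfolding cochains_0 \<phi>(2) by auto
  then show "\<xi> \<in> cochains_gt sgh 0"
    by (auto simp: cochains_gt_def \<phi>(2) cochain_of_map_def \<phi>.zero zero_prod_def)
qed

text \<open>Iterating \<open>ad\<close> yields repeated equal summands; these rules absorb them into
  the coefficients of the exponential series.\<close>

lemma sgh_fraction:
  "sgh (1 / 2) (a + a) = a" "sgh (1 / 6) (a + a + a + a + a + a) = a"
proof -
  have "a + a = sgh 2 a" for a
    using p.scale_left_distrib[of 1 1 a] by simp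
  moreover have "a + a + a + a + a + a = sgh 6 a"
    using p.scale_left_distrib[of 1 1 a] p.scale_left_distrib[of 2 1 a] p.scale_left_distrib[of 3 1 a]
      p.scale_left_distrib[of 4 1 a] p.scale_left_distrib[of 5 1 a] by simp
  ultimately show "sgh (1 / 2) (a + a) = a" "sgh (1 / 6) (a + a + a + a + a + a) = a"
    by simp_all
qed

text \<open>
  The expansions of \<open>exp\<close> stop at degree two: \<open>ad\<^sup>3\<close> substitutes \<open>\<xi>\<close> into all three
  arguments, where \<open>P\<close> and \<open>d \<xi>\<close> vanish.
\<close>

lemma gauge_action_iff:
  assumes p: "split_ext p \<in> extensions G H" and \<phi>: "Vector_Spaces.linear sg sh \<phi>"
  shows "cochain_of_bracket q = gauge_action L (cochain_of_map (nil \<phi>)) (cochain_of_bracket p) \<longleftrightarrow>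
    (\<forall>x y z. \<mu> x y z + q x y z =
      (let w = \<mu> (x - nil \<phi> x) (y - nil \<phi> y) (z - nil \<phi> z)
          + p (x - nil \<phi> x) (y - nil \<phi> y) (z - nil \<phi> z)
       in w + nil \<phi> w))"
proof -
  interpret \<phi>: Vector_Spaces.linear sg sh \<phi> by (rule \<phi>)
  define n where "n = nil \<phi>"
  have n_add: "n (x + y) = n x + n y" and n_diff: "n (x - y) = n x - n y" and n_neg: "n (- x) = - n x"
    for x y by (simp_all add: n_def \<phi>.add \<phi>.diff \<phi>.neg)
  have n0: "n 0 = 0" and nn: "n (n x) = 0" and n_eq_0: "fst x = 0 \<Longrightarrow> n x = 0" for x
    by (simp_all add: n_def \<phi>.zero zero_prod_def)
  have fst_n: "fst (n x) = 0" for x by (simp add: n_def)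
  from p have alt: "alternating3 sgh p" and fst_p: "fst (p x y z) = 0"
    and ppp: "p (n x) (n y) (n z) = 0" for x y z
    unfolding split_ext_in_extensions_iff n_def by blast+
  have np: "n (p x y z) = 0" for x y z by (rule n_eq_0[OF fst_p])
  \<comment> \<open>An argument from \<hh> kills the \<gg>-component of \<mu>, on which alone
    \<open>n\<close> depends.\<close>
  have n\<mu>: "n (\<mu> (n x) y z) = 0" "n (\<mu> x (n y) z) = 0" "n (\<mu> x y (n z)) = 0" for x y z
    by (rule n_eq_0; simp add: sum_bracket_def fst_n alternating3_simps[OF alternating3_bg])+
  \<comment> \<open>\<open>ad\<close> and \<open>d\<close> are [\<xi>, -] and the differential of
    \<xi>, read on trilinear operations; in particular \<open>d\<close> is the negative of
    \<open>ad \<mu>\<close>.\<close>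
  define ad where "ad f = (\<lambda>x y z. n (f x y z) - insertion n f x y z)" for f
  define d where "d = (\<lambda>x y z. insertion n \<mu> x y z - n (\<mu> x y z))"
  note expand = ad_def d_def insertion_def alternating3_simps[OF alt]
    alternating3_simps[OF alternating3_sum] n_add n_diff n_neg n0 nn np ppp n\<mu>
  \<comment> \<open>\<open>?T\<close> and \<open>?U\<close> collect the terms with \<open>n\<close>
    in two slots, \<open>?W\<close> is the term with \<open>n\<close> in all three. Two slots are
    filled in 2 orders and three in 6, whence the multiplicities below.\<close>
  let ?T = "\<lambda>x y z. p (n x) (n y) z + p (n x) y (n z) + p x (n y) (n z)"
  let ?U = "\<lambda>x y z. \<mu> (n x) (n y) z + \<mu> (n x) y (n z) + \<mu> x (n y) (n z)"
  let ?W = "\<lambda>x y z. \<mu> (n x) (n y) (n z)"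
  have ad1p: "ad p = (\<lambda>x y z. - insertion n p x y z)"
    by (simp add: ad_def np)
  have ad2p: "ad (ad p) = (\<lambda>x y z. ?T x y z + ?T x y z)"
    unfolding ad1p by (simp add: expand fun_eq_iff)
  have ad3p: "ad (ad (ad p)) = (\<lambda>x y z. 0)"
    unfolding ad2p by (simp add: expand fun_eq_iff)
  have ad1d: "ad d = (\<lambda>x y z. - (?U x y z + ?U x y z))"
    by (simp add: expand fun_eq_iff)
  have ad2d: "ad (ad d) = (\<lambda>x y z. ?W x y z + ?W x y z + ?W x y z + ?W x y z + ?W x y z + ?W x y z)"
    unfolding ad1d by (simp add: expand fun_eq_iff)
  have ad3d: "ad (ad (ad d)) = (\<lambda>x y z. 0)"
    unfolding ad2d by (simp add: expand fun_eq_iff)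
  define A where "A = dg_bracket L 0 1 (cochain_of_map n)"
  have AD: "A (cochain_of_bracket f) = cochain_of_bracket (ad f)" for f
    using bracket_3Lie_0_1[where \<phi>=n and f=f, OF vector_space_sgh n0] by (simp add: A_def ad_def)
  have AD2: "(A ^^ 2) (cochain_of_bracket f) = cochain_of_bracket (ad (ad f))" for f
    by (simp add: numeral_2_eq_2 AD)
  have dn: "dg_diff L 0 (cochain_of_map n) = cochain_of_bracket d"
    using bracket_3Lie_1_0[where \<phi>=n and f=\<mu>, OF vector_space_sgh n0] by (simp add: d_def)
  have AD0: "A 0 = 0"
  proof -
    have "ad (\<lambda>x y z. 0) = (\<lambda>x y z. 0)" by (simp add: ad_def insertion_def n0)
    then show ?thesis using AD[of "\<lambda>x y z. 0"] by (simp only: cochain_of_bracket_arith)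
  qed
  have ADp: "(A ^^ k) (cochain_of_bracket p) = 0" "(A ^^ k) (cochain_of_bracket d) = 0"
    if "3 \<le> k" for k
    by (rule funpow_eq_zero[where f=A, OF _ AD0 that],
        simp add: numeral_3_eq_3 AD ad3p ad3d cochain_of_bracket_arith)+
  \<comment> \<open>The exponent in the second series is \<open>k - 1\<close>, so its term at
    \<open>k = 3\<close> still involves the second power of \<open>A\<close>; four indices cover
    both series.\<close>
  have four: "(\<Sum>k<4. F k) = F 0 + F 1 + F 2 + F (3 :: nat)" for F :: "nat \<Rightarrow> ('g \<times> 'h) cochain"
    by (simp add: eval_nat_numeral)
  have cochain_scale_zero: "cochain_scale sgh c 0 = 0" for c
    by (simp add: cochain_scale_def fun_eq_iff)
  have "Sum_any (\<lambda>k. dg_scale L (1 / fact k) ((A ^^ k) (cochain_of_bracket p))) =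
      (\<Sum>k<4. dg_scale L (1 / fact k) ((A ^^ k) (cochain_of_bracket p)))"
  proof (rule Sum_any.expand_superset)
    have "dg_scale L (1 / fact k) ((A ^^ k) (cochain_of_bracket p)) = 0" if "\<not> k < 4" for k
      using ADp(1)[of k] that by (simp add: cochain_scale_zero)
    then show "{k. dg_scale L (1 / fact k) ((A ^^ k) (cochain_of_bracket p)) \<noteq> 0} \<subseteq> {..<4}"
      by blast
  qed simp
  also have "\<dots> = cochain_of_bracket (\<lambda>x y z. p x y z - insertion n p x y z + ?T x y z)"
    unfolding four using ADp(1)[of 3]
    by (simp add: AD AD2[of p, unfolded ad2p] ad1p cochain_scale_cochain_of_bracket vector_space_sgh fact_numeral
        cochain_scale_zero sgh_fraction cochain_of_bracket_arith)
  finally have S1: "Sum_any (\<lambda>k. dg_scale L (1 / fact k) ((A ^^ k) (cochain_of_bracket p))) =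
    cochain_of_bracket (\<lambda>x y z. p x y z - insertion n p x y z + ?T x y z)" .
  have "Sum_any (\<lambda>k. if k = 0 then 0
        else dg_scale L (1 / fact k) ((A ^^ (k - 1)) (dg_diff L 0 (cochain_of_map n)))) =
      (\<Sum>k<4. if k = 0 then 0
        else dg_scale L (1 / fact k) ((A ^^ (k - 1)) (dg_diff L 0 (cochain_of_map n))))"
  proof (rule Sum_any.expand_superset)
    have "dg_scale L (1 / fact k) ((A ^^ (k - 1)) (dg_diff L 0 (cochain_of_map n))) = 0"
      if "\<not> k < 4" for k
      unfolding dn using ADp(2)[of "k - 1"] that by (simp add: cochain_scale_zero)
    then show "{k. (if k = 0 then 0
        else dg_scale L (1 / fact k) ((A ^^ (k - 1)) (dg_diff L 0 (cochain_of_map n)))) \<noteq> 0}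
      \<subseteq> {..<4}"
      by auto
  qed simp
  also have "\<dots> = cochain_of_bracket (\<lambda>x y z. d x y z - ?U x y z + ?W x y z)"
    unfolding dn four
    by (simp add: AD AD2[of d, unfolded ad2d] ad1d cochain_scale_cochain_of_bracket
        vector_space_sgh fact_numeral sgh_fraction cochain_of_bracket_arith)
      (simp add: fun_eq_iff algebra_simps)
  finally have S2: "Sum_any (\<lambda>k. if k = 0 then 0
        else dg_scale L (1 / fact k) ((A ^^ (k - 1)) (dg_diff L 0 (cochain_of_map n)))) =
    cochain_of_bracket (\<lambda>x y z. d x y z - ?U x y z + ?W x y z)" .
  let ?r = "\<lambda>x y z. (p x y z - insertion n p x y z + ?T x y z) - (d x y z - ?U x y z + ?W x y z)"
  have gauge: "gauge_action L (cochain_of_map n) (cochain_of_bracket p) = cochain_of_bracket ?r"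
    unfolding gauge_action_def Let_def A_def[symmetric] S1 S2 cochain_of_bracket_arith ..
  \<comment> \<open>Trilinear expansion of the conjugate of \<mu> + p by 1 + n. In the outer summand
    \<open>n w\<close> only \<open>n (\<mu> x y z)\<close> survives.\<close>
  have conj: "\<mu> x y z + ?r x y z =
      (let w = \<mu> (x - n x) (y - n y) (z - n z) + p (x - n x) (y - n y) (z - n z) in w + n w)" for x y z
    unfolding Let_def by (simp add: expand)
  have "cochain_of_bracket q = gauge_action L (cochain_of_map n) (cochain_of_bracket p) \<longleftrightarrow>
      (\<forall>x y z. \<mu> x y z + q x y z = \<mu> x y z + ?r x y z)"
    unfolding gauge cochain_of_bracket_eq_iff add_left_cancel by (simp only: fun_eq_iff)
  then show ?thesis
    unfolding conj unfolding n_def .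
qed

text \<open>Conjugation by 1 + \<xi> carrying \<mu> + p to \<mu> + q means that 1 + \<xi> is a
  morphism from the extension of \<open>p\<close> to that of \<open>q\<close>. The order on the
  right is reversed because \<open>ext_isomorphic\<close> takes the target first.\<close>

lemma gauge_rel_iff:
  assumes p: "split_ext p \<in> extensions G H" and q: "split_ext q \<in> extensions G H"
  shows "(cochain_of_bracket p, cochain_of_bracket q) \<in> gauge_rel L \<longleftrightarrow>
    ext_isomorphic H (split_ext q) (split_ext p)"
proof -
  let ?P = "\<lambda>x y z. \<mu> x y z + p x y z" and ?Q = "\<lambda>x y z. \<mu> x y z + q x y z"
  have "(cochain_of_bracket p, cochain_of_bracket q) \<in> gauge_rel L \<longleftrightarrow>
      (\<exists>\<phi>. Vector_Spaces.linear sg sh \<phi> \<and>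
        cochain_of_bracket q = gauge_action L (cochain_of_map (nil \<phi>)) (cochain_of_bracket p))"
    using p q unfolding gauge_rel_def by (auto simp: MC_iff cochains_gt_0)
  also have "\<dots> \<longleftrightarrow> (\<exists>\<phi>. Vector_Spaces.linear sg sh \<phi> \<and>
      (\<forall>x y z. ?P x y z + nil \<phi> (?P x y z) = ?Q (x + nil \<phi> x) (y + nil \<phi> y) (z + nil \<phi> z)))"
  proof (intro ex_cong1 conj_cong refl)
    fix \<phi> assume \<phi>: "Vector_Spaces.linear sg sh \<phi>"
    interpret \<phi>: Vector_Spaces.linear sg sh \<phi> by (rule \<phi>)
    \<comment> \<open>These mutually inverse substitutions turn the conjugation formula into the
      morphism property and back.\<close>
    have inv: "x + nil \<phi> x - nil \<phi> (x + nil \<phi> x) = x" "x - nil \<phi> x + nil \<phi> (x - nil \<phi> x) = x" for x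
      by (simp_all add: prod_eq_iff)
    show "cochain_of_bracket q = gauge_action L (cochain_of_map (nil \<phi>)) (cochain_of_bracket p) \<longleftrightarrow>
      (\<forall>x y z. ?P x y z + nil \<phi> (?P x y z) = ?Q (x + nil \<phi> x) (y + nil \<phi> y) (z + nil \<phi> z))"
      unfolding gauge_action_iff[OF p \<phi>] Let_def
    proof (intro iffI allI)
      fix x y z
      assume *: "\<forall>x y z. ?Q x y z =
        ?P (x - nil \<phi> x) (y - nil \<phi> y) (z - nil \<phi> z) +
          nil \<phi> (?P (x - nil \<phi> x) (y - nil \<phi> y) (z - nil \<phi> z))"
      show "?P x y z + nil \<phi> (?P x y z) = ?Q (x + nil \<phi> x) (y + nil \<phi> y) (z + nil \<phi> z)"
        using *[rule_format, of "x + nil \<phi> x" "y + nil \<phi> y" "z + nil \<phi> z"] unfolding inv by (rule sym)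
    next
      fix x y z
      assume *: "\<forall>x y z. ?P x y z + nil \<phi> (?P x y z) = ?Q (x + nil \<phi> x) (y + nil \<phi> y) (z + nil \<phi> z)"
      show "?Q x y z = ?P (x - nil \<phi> x) (y - nil \<phi> y) (z - nil \<phi> z) +
          nil \<phi> (?P (x - nil \<phi> x) (y - nil \<phi> y) (z - nil \<phi> z))"
        using *[rule_format, of "x - nil \<phi> x" "y - nil \<phi> y" "z - nil \<phi> z"] unfolding inv by (rule sym)
    qed
  qed
  also have "\<dots> \<longleftrightarrow> ext_isomorphic H (split_ext q) (split_ext p)"
  proof
    assume "\<exists>\<phi>. Vector_Spaces.linear sg sh \<phi> \<and>
      (\<forall>x y z. ?P x y z + nil \<phi> (?P x y z) = ?Q (x + nil \<phi> x) (y + nil \<phi> y) (z + nil \<phi> z))"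
    then obtain \<phi> where \<phi>: "Vector_Spaces.linear sg sh \<phi>"
      and br: "\<And>x y z. ?P x y z + nil \<phi> (?P x y z) = ?Q (x + nil \<phi> x) (y + nil \<phi> y) (z + nil \<phi> z)"
      by blast
    interpret \<phi>: Vector_Spaces.linear sg sh \<phi> by (rule \<phi>)
    have "Vector_Spaces.linear sgh sgh (\<lambda>x. x + nil \<phi> x)"
      by (simp add: Vector_Spaces.linear_iff vector_space_sgh \<phi>.add \<phi>.scale scale_def
          vh.scale_right_distrib)
    then have "(\<lambda>x. x + nil \<phi> x) \<in> three_lie_morphisms (middle (split_ext p)) (middle (split_ext q))"
      unfolding three_lie_morphisms_def
      using br by (simp add: linear_maps_type_algebra3_iff vector_space_sgh del: split_paired_All)
    then show "ext_isomorphic H (split_ext q) (split_ext p)"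
      unfolding ext_isomorphic_def by (rule bexI[rotated]) (simp add: \<phi>.zero)
  next
    assume "ext_isomorphic H (split_ext q) (split_ext p)"
    then obtain \<theta> where \<theta>: "Vector_Spaces.linear sgh sgh \<theta>"
      and br: "\<And>x y z. \<theta> (?P x y z) = ?Q (\<theta> x) (\<theta> y) (\<theta> z)"
      and \<theta>0: "\<And>u. \<theta> (0, u) = (0, u)" and fst: "\<And>x. fst (\<theta> x) = fst x"
      unfolding ext_isomorphic_def
      by (simp add: three_lie_morphisms_def linear_maps_type_algebra3_iff vector_space_sgh
          del: split_paired_All) blast
    interpret \<theta>: Vector_Spaces.linear sgh sgh \<theta> by (rule \<theta>)
    \<comment> \<open>The block of \<open>\<theta>\<close> from \<gg> to \<hh>; compatibility with
      injection and projection fixes the other three blocks.\<close>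
    define \<phi> where "\<phi> a = snd (\<theta> (a, 0))" for a
    have eq: "x + nil \<phi> x = \<theta> x" for x
    proof -
      have "\<theta> x = \<theta> ((fst x, 0) + (0, snd x))" by simp
      also have "\<dots> = \<theta> (fst x, 0) + (0, snd x)" unfolding \<theta>.add \<theta>0 ..
      finally show ?thesis using fst by (simp add: \<phi>_def prod_eq_iff)
    qed
    have "Vector_Spaces.linear sg sh \<phi>"
      unfolding Vector_Spaces.linear_iff \<phi>_def
      using \<theta>.add[of "(_, 0)" "(_, 0)"] \<theta>.scale[of _ "(_, 0)"]
      by (simp add: vg.vector_space_axioms vh.vector_space_axioms scale_def)
    moreover have "?P x y z + nil \<phi> (?P x y z) = ?Q (x + nil \<phi> x) (y + nil \<phi> y) (z + nil \<phi> z)" for x y z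
      unfolding eq by (rule br)
    ultimately show "\<exists>\<phi>. Vector_Spaces.linear sg sh \<phi> \<and>
      (\<forall>x y z. ?P x y z + nil \<phi> (?P x y z) = ?Q (x + nil \<phi> x) (y + nil \<phi> y) (z + nil \<phi> z))"
      by (intro exI[of _ \<phi>] conjI allI)
  qed
  finally show ?thesis .
qed

end

section \<open>Every extension splits linearly\<close>

text \<open>Lift a basis of the target along \<open>f\<close> and extend linearly. Coordinates come
  from \<open>representation\<close> on the type, while the lifts are combined by
  \<open>finsum\<close> in the carrier-based module \<open>M\<close>.\<close>

lemma exists_linear_section:
  fixes sg :: "'k::field \<Rightarrow> 'g::ab_group_add \<Rightarrow> 'g"
  assumes M: "three_lie_algebra M" and vs: "vector_space sg"
    and f: "f \<in> linear_maps M (type_algebra3 sg b)" and surj: "f ` carrier M = UNIV"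
  shows "\<exists>\<sigma> \<in> linear_maps (type_algebra3 sg b) M. \<forall>x. f (\<sigma> x) = x"
proof -
  interpret M: three_lie_algebra M by (rule M)
  interpret vector_space sg by (rule vs)
  obtain B where B: "independent B" "span B = UNIV"
    using independent_extend_basis span_extend_basis independent_empty by blast
  have "\<forall>x. \<exists>y\<in>carrier M. f y = x" using surj by (metis UNIV_I imageE)
  then obtain t where t: "\<And>x. t x \<in> carrier M" "\<And>x. f (t x) = x" by metis
  have smc: "c \<odot>\<^bsub>M\<^esub> x \<in> carrier M" if "x \<in> carrier M" for c x
    using M.smult_closed that by simp
  let ?R = "representation B"
  \<comment> \<open>The index set is a parameter, so that \<open>x\<close>, \<open>y\<close> and
    their sum can be expanded over one finite set containing all the supports.\<close>
  define S where "S A x = finsum M (\<lambda>e. ?R x e \<odot>\<^bsub>M\<^esub> t e) A" for A x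
  define \<sigma> where "\<sigma> x = S {e. ?R x e \<noteq> 0} x" for x
  have S_mono: "S A x = \<sigma> x" if "finite A" "{e. ?R x e \<noteq> 0} \<subseteq> A" for A x
    unfolding S_def \<sigma>_def
    by (rule M.add.finprod_mono_neutral_cong_left[symmetric])
      (use that t in \<open>auto simp: smc M.smult_l_null[simplified]\<close>)
  have S_closed: "S A x \<in> carrier M" for A x
    unfolding S_def by (rule M.finsum_closed) (simp add: smc t)
  have f_S: "f (S A x) = (\<Sum>e\<in>A. sg (?R x e) e)" if "finite A" for A x
    using that unfolding S_def
  proof (induction A rule: finite_induct)
    case empty
    then show ?case
      using linear_mapsD(2)[OF f, of "\<zero>\<^bsub>M\<^esub>" "\<zero>\<^bsub>M\<^esub>"] by simp
  next
    case (insert e A)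
    then have "finsum M (\<lambda>e. ?R x e \<odot>\<^bsub>M\<^esub> t e) (insert e A) =
        ?R x e \<odot>\<^bsub>M\<^esub> t e \<oplus>\<^bsub>M\<^esub> finsum M (\<lambda>e. ?R x e \<odot>\<^bsub>M\<^esub> t e) A"
      by (intro M.finsum_insert) (auto simp: smc t)
    then show ?case
      using insert S_closed[of A x, unfolded S_def] by (simp add: linear_mapsD[OF f] smc t)
  qed
  show ?thesis
  proof (intro bexI allI)
    fix x
    have "f (\<sigma> x) = (\<Sum>e | ?R x e \<noteq> 0. sg (?R x e) e)"
      unfolding \<sigma>_def by (rule f_S) (rule finite_representation)
    also have "\<dots> = x" using B by (intro sum_nonzero_representation_eq) auto
    finally show "f (\<sigma> x) = x" .
  next
    have "\<sigma> (x + y) = \<sigma> x \<oplus>\<^bsub>M\<^esub> \<sigma> y" for x y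
    proof -
      let ?A = "{e. ?R x e \<noteq> 0} \<union> {e. ?R y e \<noteq> 0}"
      have fin: "finite ?A" using finite_representation by auto
      have add: "?R (x + y) e = ?R x e + ?R y e" for e using B by (simp add: representation_add)
      have "\<sigma> (x + y) = S ?A (x + y)" by (rule S_mono[OF fin, symmetric]) (auto simp: add)
      also have "\<dots> = finsum M (\<lambda>e. ?R x e \<odot>\<^bsub>M\<^esub> t e \<oplus>\<^bsub>M\<^esub> ?R y e \<odot>\<^bsub>M\<^esub> t e) ?A"
        unfolding S_def add using M.smult_l_distr[simplified] t by simp
      also have "\<dots> = S ?A x \<oplus>\<^bsub>M\<^esub> S ?A y"
        unfolding S_def by (rule M.finsum_addf) (auto simp: smc t)
      also have "\<dots> = \<sigma> x \<oplus>\<^bsub>M\<^esub> \<sigma> y"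
        using S_mono[OF fin] by simp
      finally show ?thesis .
    qed
    moreover have "\<sigma> (sg c x) = c \<odot>\<^bsub>M\<^esub> \<sigma> x" for c x
    proof -
      let ?A = "{e. ?R x e \<noteq> 0}"
      have fin: "finite ?A" by (rule finite_representation)
      have scale: "?R (sg c x) e = c * ?R x e" for e using B by (simp add: representation_scale)
      have "\<sigma> (sg c x) = S ?A (sg c x)" by (rule S_mono[OF fin, symmetric]) (auto simp: scale)
      also have "\<dots> = finsum M (\<lambda>e. c \<odot>\<^bsub>M\<^esub> (?R x e \<odot>\<^bsub>M\<^esub> t e)) ?A"
        unfolding S_def scale using M.smult_assoc1[simplified] t by simp
      also have "\<dots> = c \<odot>\<^bsub>M\<^esub> S ?A x"
        unfolding S_def by (rule M.finsum_smult_ldistr[symmetric]) (auto simp: fin smc t)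
      finally show ?thesis by (simp add: \<sigma>_def)
    qed
    ultimately show "\<sigma> \<in> linear_maps (type_algebra3 sg b) M"
      by (simp add: linear_maps_def \<sigma>_def S_closed)
  qed
qed

section \<open>Arbitrary extensions compared with those on \<gg> \<oplus> \<hh>\<close>

context three_lie_pair
begin

text \<open>A linear section \<open>\<sigma>\<close> and the injection combine to a linear bijection
  \<open>\<psi>\<close> from \<gg> \<oplus> \<hh> to the middle term. Pulling the bracket back along
  \<open>\<psi>\<close> makes \<open>\<psi>\<close> an isomorphism of extensions.\<close>

lemma extension_isomorphic_split_ext:
  assumes X: "X \<in> extensions G H"
  shows "\<exists>p. split_ext p \<in> extensions G H \<and> ext_isomorphic H X (split_ext p)"
proof -
  note E = extensionsD[OF X]
  let ?M = "middle X"
  interpret M: three_lie_algebra ?M by (rule E)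
  have smc: "c \<odot>\<^bsub>?M\<^esub> x \<in> carrier ?M" if "x \<in> carrier ?M" for c x
    using M.smult_closed that by simp
  have "proj X ` carrier ?M = UNIV" using E(6) by simp
  with exists_linear_section[OF E(1) vg.vector_space_axioms E(8)]
  obtain \<sigma> where \<sigma>: "\<sigma> \<in> linear_maps G ?M" "\<And>x. proj X (\<sigma> x) = x" by blast
  note cl = linear_mapsD(1)[OF \<sigma>(1), simplified] linear_mapsD(1)[OF E(7), simplified]
  note hom = linear_mapsD(2,3)[OF \<sigma>(1), simplified] linear_mapsD(2,3)[OF E(7), simplified]
    linear_mapsD(2,3)[OF E(8), simplified]
  have proj_incl: "proj X (incl X u) = 0" for u using E(5) by auto
  define \<psi> where "\<psi> x = \<sigma> (fst x) \<oplus>\<^bsub>?M\<^esub> incl X (snd x)" for x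
  have \<psi>_cl: "\<psi> x \<in> carrier ?M" for x by (simp add: \<psi>_def cl)
  have \<psi>_add: "\<psi> (x + y) = \<psi> x \<oplus>\<^bsub>?M\<^esub> \<psi> y" for x y
    by (simp add: \<psi>_def hom cl M.a_ac)
  have \<psi>_scale: "\<psi> (sgh c x) = c \<odot>\<^bsub>?M\<^esub> \<psi> x" for c x
    by (simp add: \<psi>_def hom cl scale_def M.smult_r_distr[simplified])
  have \<psi>_incl: "\<psi> (0, u) = incl X u" for u
    using linear_maps_zero[OF three_lie_G E(1) \<sigma>(1)] by (simp add: \<psi>_def cl)
  have proj_\<psi>: "proj X (\<psi> x) = fst x" for x
    by (simp add: \<psi>_def hom cl \<sigma>(2) proj_incl)
  have bij: "bij_betw \<psi> UNIV (carrier ?M)"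
    unfolding bij_betw_def
  proof (intro conjI injI equalityI subsetI)
    fix x y assume eq: "\<psi> x = \<psi> y"
    then have "fst x = fst y" using proj_\<psi> by metis
    then have "incl X (snd x) = incl X (snd y)"
      using eq cl by (simp add: \<psi>_def M.a_comm[of "\<sigma> _"] M.add.right_cancel)
    then have "snd x = snd y" using E(4) by (simp add: inj_on_eq_iff)
    then show "x = y" using \<open>fst x = fst y\<close> by (simp add: prod_eq_iff)
  next
    fix y assume y: "y \<in> carrier ?M"
    have "proj X (y \<ominus>\<^bsub>?M\<^esub> \<sigma> (proj X y)) = 0"
      using linear_maps_minus[OF E(1) three_lie_G E(8) y cl(1)] \<sigma>(2)
      by (simp add: a_minus_def)
    then have "y \<ominus>\<^bsub>?M\<^esub> \<sigma> (proj X y) \<in> incl X ` carrier H"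
      unfolding E(5) using M.minus_closed[OF y cl(1)] by simp
    then obtain u where u: "y \<ominus>\<^bsub>?M\<^esub> \<sigma> (proj X y) = incl X u" by auto
    have "y = \<sigma> (proj X y) \<oplus>\<^bsub>?M\<^esub> (y \<ominus>\<^bsub>?M\<^esub> \<sigma> (proj X y))"
      using y cl by (simp add: a_minus_def M.a_lcomm M.r_neg)
    then have "y = \<psi> (proj X y, u)" by (simp add: u \<psi>_def)
    then show "y \<in> range \<psi>" by blast
  qed (use \<psi>_cl in auto)
  define \<eta> where "\<eta> = inv_into UNIV \<psi>"
  have \<eta>\<psi>: "\<eta> (\<psi> x) = x" for x using bij by (simp add: \<eta>_def bij_betw_def)
  have \<psi>\<eta>: "\<psi> (\<eta> y) = y" if "y \<in> carrier ?M" for y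
    using bij that by (simp add: \<eta>_def bij_betw_def f_inv_into_f)
  have brc: "bracket ?M (\<psi> x) (\<psi> y) (\<psi> z) \<in> carrier ?M" for x y z
    by (rule three_lie_algebra_bracket_closed[OF E(1) \<psi>_cl \<psi>_cl \<psi>_cl])
  define \<pi> where "\<pi> x y z = \<eta> (bracket ?M (\<psi> x) (\<psi> y) (\<psi> z))" for x y z
  \<comment> \<open>Chosen so that the middle term of \<open>split_ext p\<close> carries exactly the
    transported bracket \<open>\<pi>\<close>.\<close>
  define p where "p x y z = \<pi> x y z - \<mu> x y z" for x y z
  have \<psi>_br: "\<psi> (\<pi> x y z) = bracket ?M (\<psi> x) (\<psi> y) (\<psi> z)" for x y z
    unfolding \<pi>_def by (rule \<psi>\<eta>[OF brc])
  have \<mu>p: "(\<lambda>x y z. \<mu> x y z + p x y z) = \<pi>" by (simp add: p_def fun_eq_iff)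
  have \<eta>_eq: "\<eta> y = x" if "y = \<psi> x" for x y using that \<eta>\<psi> by simp
  have three_lie: "three_lie_algebra (type_algebra3 sgh \<pi>)"
  proof (rule bij_three_lie_algebra[OF E(1)])
    show "bij_betw \<eta> (carrier ?M) (carrier (type_algebra3 sgh \<pi>))"
      using bij_betw_inv_into[OF bij] by (simp add: \<eta>_def)
    have "\<psi> 0 = \<zero>\<^bsub>?M\<^esub>"
      using \<psi>_incl[of 0] linear_maps_zero[OF three_lie_H E(1) E(7)] by (simp add: zero_prod_def)
    then show "\<eta> \<zero>\<^bsub>?M\<^esub> = \<zero>\<^bsub>type_algebra3 sgh \<pi>\<^esub>" by (simp add: \<eta>_eq)
  qed (auto intro!: \<eta>_eq simp: \<psi>_add \<psi>_scale \<psi>_br \<psi>\<eta>)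
  have "Pair 0 \<in> three_lie_morphisms H (type_algebra3 sgh \<pi>)"
  proof -
    have "\<pi> (0, u) (0, v) (0, w) = (0, bh u v w)" for u v w
      unfolding \<pi>_def using E(2) by (intro \<eta>_eq) (simp add: \<psi>_incl three_lie_morphisms_def)
    then show ?thesis
      using linear_Pair_0 by (simp add: three_lie_morphisms_def linear_maps_type_algebra3_iff
          vector_space_sgh vh.vector_space_axioms)
  qed
  moreover have "fst \<in> three_lie_morphisms (type_algebra3 sgh \<pi>) G"
  proof -
    have "fst (\<pi> x y z) = bg (fst x) (fst y) (fst z)" for x y z
      using proj_\<psi>[of "\<pi> x y z"] E(3) \<psi>_cl by (simp add: \<psi>_br three_lie_morphisms_def proj_\<psi>)
    then show ?thesis
      using linear_fst by (simp add: three_lie_morphisms_def linear_maps_type_algebra3_iff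
          vector_space_sgh vg.vector_space_axioms)
  qed
  moreover have "range (Pair 0) = {x. fst x = (0 :: 'g)}" by force
  ultimately have ext: "split_ext p \<in> extensions G H"
    using three_lie by (auto simp: extensions_def inj_on_def \<mu>p)
  have "\<psi> \<in> three_lie_morphisms (middle (split_ext p)) ?M"
    using \<psi>_cl by (simp add: three_lie_morphisms_def linear_maps_def \<mu>p \<psi>_add \<psi>_scale \<psi>_br
        del: split_paired_All)
  then have "ext_isomorphic H X (split_ext p)"
    unfolding ext_isomorphic_def
    by (rule bexI[rotated]) (simp add: \<psi>_incl proj_\<psi>)
  with ext show ?thesis by blast
qed

text \<open>The extensions being classified have their carriers in \<open>'u\<close>, whereas
  \<open>split_ext p\<close> lives on \<open>'g \<times> 'h\<close>. Its structure is copied onto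
  the range of \<open>emb\<close>.\<close>

lemma split_ext_isomorphic_extension:
  fixes emb :: "'g \<times> 'h \<Rightarrow> 'u"
  assumes emb: "inj emb" and p: "split_ext p \<in> extensions G H"
  shows "\<exists>X \<in> (extensions G H :: ('k, 'h, 'u, 'g) extension set). ext_isomorphic H X (split_ext p)"
proof -
  let ?\<pi> = "\<lambda>x y z. \<mu> x y z + p x y z"
  let ?e = "inv_into UNIV emb"
  define M :: "('k, 'u) algebra3" where
    "M = \<lparr>carrier = range emb, monoid.mult = (\<lambda>_ _. emb 0), one = emb 0, ring.zero = emb 0,
      add = (\<lambda>a b. emb (?e a + ?e b)), module.smult = (\<lambda>c a. emb (sgh c (?e a))),
      bracket = (\<lambda>a b c. emb (?\<pi> (?e a) (?e b) (?e c)))\<rparr>"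
  define X where "X = \<lparr>middle = M, incl = (\<lambda>u. emb (0, u)), proj = fst \<circ> ?e\<rparr>"
  have [simp]: "?e (emb x) = x" for x using emb by simp
  have M [simp]: "carrier M = range emb" "\<zero>\<^bsub>M\<^esub> = emb 0" "emb x \<oplus>\<^bsub>M\<^esub> emb y = emb (x + y)"
    "c \<odot>\<^bsub>M\<^esub> emb x = emb (sgh c x)" "bracket M (emb x) (emb y) (emb z) = emb (?\<pi> x y z)" for c x y z
    by (simp_all add: M_def)
  note E = extensionsD[OF p, simplified]
  have "three_lie_algebra M"
    by (rule bij_three_lie_algebra[OF E(1), of emb]) (simp_all add: emb inj_on_imp_bij_betw)
  moreover have "incl X \<in> three_lie_morphisms H M"
    using E(2) by (simp add: X_def three_lie_morphisms_def linear_maps_def)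
  moreover have "proj X \<in> three_lie_morphisms M G"
    using E(3) by (simp add: X_def three_lie_morphisms_def linear_maps_def del: split_paired_All)
  moreover have "inj_on (incl X) (carrier H)"
    using emb by (auto simp: X_def inj_on_def)
  moreover have "incl X ` carrier H = {x \<in> carrier M. proj X x = \<zero>\<^bsub>G\<^esub>}"
    by (auto simp: X_def)
  moreover have "proj X ` carrier M = carrier G"
    by (auto simp: X_def image_image)
  ultimately have "X \<in> extensions G H"
    by (simp add: extensions_def X_def)
  moreover have "ext_isomorphic H X (split_ext p)"
    unfolding ext_isomorphic_def
    by (intro bexI[of _ emb])
      (simp_all add: X_def three_lie_morphisms_def linear_maps_def del: split_paired_All)
  ultimately show ?thesis by blast
qed

end

text \<open>\<open>quotient_bij_betw\<close> is applied to the relation that an extension is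
  isomorphic to the one given by a Maurer-Cartan element. Isomorphism compares extensions on
  different types here, so its symmetry and transitivity are used across types.\<close>

theorem theorem4p6:
  fixes sg :: "'k::{alg_closed_field, field_char_0} \<Rightarrow> 'g::ab_group_add \<Rightarrow> 'g"
    and sh :: "'k \<Rightarrow> 'h::ab_group_add \<Rightarrow> 'h"
    and bg :: "'g \<Rightarrow> 'g \<Rightarrow> 'g \<Rightarrow> 'g"
    and bh :: "'h \<Rightarrow> 'h \<Rightarrow> 'h \<Rightarrow> 'h"
    and emb :: "'g \<times> 'h \<Rightarrow> 'u"
  defines "G \<equiv> type_algebra3 sg bg"
    and "H \<equiv> type_algebra3 sh bh"
    and "L \<equiv> dgla_gt sg sh bg bh"
  assumes "three_lie_algebra G"
    and "three_lie_algebra H"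
    \<comment> \<open>The carriers of the extensions are subsets of an arbitrary, large enough type.\<close>
    and "inj emb"
  shows "\<exists>F. bij_betw F
           ((extensions G H :: ('k, 'h, 'u, 'g) extension set) // ext_rel G H)
           (MC L // gauge_rel L) \<and>
         (\<forall>E \<in> (extensions G H :: ('k, 'h, 'u, 'g) extension set). \<forall>P \<in> MC L.
            F (ext_rel G H `` {E}) = gauge_rel L `` {P} \<longleftrightarrow>
            ext_isomorphic H E (mc_extension sg sh bg bh P))"
proof -
  note three_lie = assms(4,5)
  interpret three_lie_pair sg sh bg bh
    using three_lie by (simp add: three_lie_pair_def G_def H_def)
  note sym = ext_isomorphic_sym[OF three_lie]
  have MC: "P \<in> MC L \<longleftrightarrow> (\<exists>p. P = cochain_of_bracket p \<and> split_ext p \<in> extensions G H)" for P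
    unfolding L_def G_def H_def by (rule MC_iff)
  have gauge: "(P, Q) \<in> gauge_rel L \<longleftrightarrow>
      ext_isomorphic H (mc_extension sg sh bg bh Q) (mc_extension sg sh bg bh P)"
    if "P \<in> MC L" "Q \<in> MC L" for P Q
  proof -
    from that obtain p q where "P = cochain_of_bracket p" "split_ext p \<in> extensions G H"
      "Q = cochain_of_bracket q" "split_ext q \<in> extensions G H" unfolding MC by blast
    then show ?thesis
      using gauge_rel_iff[of p q] unfolding L_def G_def H_def by simp
  qed
  have ext: "mc_extension sg sh bg bh P \<in> extensions G H" if "P \<in> MC L" for P
    using that MC by auto
  \<comment> \<open>Gauge equivalence inherits the laws of an equivalence relation from isomorphism
    of extensions through \<open>gauge\<close>; no composition law for exponentials enters.\<close>
  have equiv: "equiv (MC L) (gauge_rel L)"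
  proof (rule equivI)
    show "gauge_rel L \<subseteq> MC L \<times> MC L" by (auto simp: gauge_rel_def)
    then have dom: "P \<in> MC L \<and> Q \<in> MC L" if "(P, Q) \<in> gauge_rel L" for P Q using that by auto
    show "refl_on (MC L) (gauge_rel L)"
      by (auto simp: refl_on_def gauge ext_isomorphic_refl)
    show "Relation.sym (gauge_rel L)"
      by (rule symI) (metis dom gauge sym ext)
    show "trans (gauge_rel L)"
    proof (rule transI)
      fix P Q R assume "(P, Q) \<in> gauge_rel L" "(Q, R) \<in> gauge_rel L"
      then show "(P, R) \<in> gauge_rel L"
        using dom[of P Q] dom[of Q R] gauge[of P Q] gauge[of Q R] gauge[of P R]
        by (auto intro: ext_isomorphic_trans)
    qed
  qed
  show ?thesis
  proof (rule quotient_bij_betw[OF equiv_ext_rel[OF three_lie] equiv])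
    fix E :: "('k, 'h, 'u, 'g) extension" assume "E \<in> extensions G H"
    then show "\<exists>P\<in>MC L. ext_isomorphic H E (mc_extension sg sh bg bh P)"
      using extension_isomorphic_split_ext MC unfolding G_def H_def by blast
  next
    fix P assume "P \<in> MC L"
    then show "\<exists>E\<in>(extensions G H :: ('k, 'h, 'u, 'g) extension set).
        ext_isomorphic H E (mc_extension sg sh bg bh P)"
      using split_ext_isomorphic_extension[OF assms(6)] unfolding MC G_def H_def by blast
  next
    fix E E' :: "('k, 'h, 'u, 'g) extension" and P
    assume *: "E \<in> extensions G H" "E' \<in> extensions G H" "P \<in> MC L"
      "ext_isomorphic H E (mc_extension sg sh bg bh P)"
    show "ext_isomorphic H E' (mc_extension sg sh bg bh P) \<longleftrightarrow> (E, E') \<in> ext_rel G H"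
      using * sym[OF *(1) ext[OF *(3)]] sym[OF *(2) *(1)] sym[OF *(1,2)] sym[OF *(2) ext[OF *(3)]]
      unfolding ext_rel_def by (auto intro: ext_isomorphic_trans)
  next
    fix E :: "('k, 'h, 'u, 'g) extension" and P Q
    assume *: "E \<in> extensions G H" "P \<in> MC L" "Q \<in> MC L"
      "ext_isomorphic H E (mc_extension sg sh bg bh P)"
    show "ext_isomorphic H E (mc_extension sg sh bg bh Q) \<longleftrightarrow> (P, Q) \<in> gauge_rel L"
      unfolding gauge[OF *(2,3)]
      using * sym[OF *(1) ext[OF *(2)]] sym[OF *(1) ext[OF *(3)]]
        sym[OF ext[OF *(2)] ext[OF *(3)]] sym[OF ext[OF *(3)] ext[OF *(2)]]
      by (meson ext_isomorphic_trans)
  qed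
qed

end
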